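(* Let $X$ be a $\mathbb{Q}$-factorial projective toric variety over an algebraically closed field of characteristic $p>0$. Then its ample $F$-signature $\mathcal{a}(X)$ is positive if and only if there is a toric log Fano pair $(X,\Delta)$ of class index $1$.
   Context: Let $d=\dim X$ and $q=p^e$. For $[E]\in\mathrm{Cl}(X)$ let $m(E;q)$ be the number of torus-invariant divisors on $X$ with coefficients in $\{0,\dots,q-1\}$ linearly equivalent to $qE$. The Frobenius support $\mathrm{FS}(X)\subset N^1(X)=\mathrm{Cl}(X)/\mathrm{torsion}$ is the finite set of numerical classes $[\![E]\!]$ of those $0\ne[E]\in \mathrm{Cl}(X)$ with $m(E;q)\neq0$ for some $e>0$, and $\mathrm{AFS}(X)$ is the set of its ample elements. For $[\![E]\!]\in\mathrm{FS}(X)$ put $\tilde m(E;q)=\sum_{[T]\in\mathrm{Cl}(X)_{\mathrm{tor}}}m(E+T;q)$; there is $\alpha(E)\in[0,1]\cap\mathbb{Q}$ with $\tilde m(E;q)=\alpha(E)q^d+O(q^{d-1})$. The ample $F$-signature is $\mathcal{a}(X)=\sum_{[\![E]\!]\in\mathrm{AFS}(X)}\alpha(E)$. Let $P_1,\dots,P_r$ be the torus-invariant prime divisors. A toric boundary is a $\mathbb{Q}$-divisor $\Delta=\delta_1P_1+\cdots+\delta_rP_r$ with $\delta_i\in(0,1]\cap\mathbb{Q}$, and $(X,\Delta)$ is a toric log pair; it is KLT iff all $\delta_i<1$, and log Fano if it is KLT and $-(K_X+\Delta)$ is ample. The class index of $(X,\Delta)$ is the smallest integer $n\ge1$ such that $n(K_X+\Delta)\sim_{\mathbb{Q}}E$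 for some integral (Weil) divisor $E$ on $X$. *)

theory Defs
  imports
    "HOL-Analysis.Analysis"
    "HOL-Algebra.Coset"
    "HOL-Library.Poly_Mapping"
    "HOL-Library.Landau_Symbols"
    "HOL-Computational_Algebra.Polynomial"
begin


section \<open>Toric varieties\<close>

text \<open>
  Both the cocharacter lattice \<open>N\<close> and the character lattice \<open>M\<close> are \<open>int ^ 'n\<close>, in duality
  via the standard pairing; cones live in \<open>real ^ 'n\<close>.
\<close>

definition real_vec :: "int ^ 'n \<Rightarrow> real ^ 'n" where
  "real_vec v = (\<chi> i. real_of_int (v $ i))"

definition pairing :: "int ^ 'n \<Rightarrow> int ^ 'n \<Rightarrow> int" where
  "pairing m u = (\<Sum>i\<in>UNIV. m $ i * u $ i)"

definition rational_polyhedral_cone :: "(real ^ 'n) set \<Rightarrow> bool" where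
  "rational_polyhedral_cone \<sigma> \<longleftrightarrow> (\<exists>S. finite S \<and> \<sigma> = convex_cone hull (real_vec ` S))"

definition strongly_convex :: "(real ^ 'n) set \<Rightarrow> bool" where
  "strongly_convex \<sigma> \<longleftrightarrow> (\<forall>v. v \<in> \<sigma> \<and> - v \<in> \<sigma> \<longrightarrow> v = 0)"

text \<open>
  The predicate \<open>face_of\<close> of the library also counts the empty set as a face, which is not a
  face of a cone.
\<close>

definition is_fan :: "(real ^ 'n) set set \<Rightarrow> bool" where
  "is_fan \<Sigma> \<longleftrightarrow> finite \<Sigma> \<and> \<Sigma> \<noteq> {} \<and>
     (\<forall>\<sigma>\<in>\<Sigma>. rational_polyhedral_cone \<sigma> \<and> strongly_convex \<sigma>) \<and>
     (\<forall>\<sigma>\<in>\<Sigma>. \<forall>\<tau>. \<tau> face_of \<sigma> \<and> \<tau> \<noteq> {} \<longrightarrow> \<tau> \<in> \<Sigma>) \<and>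
     (\<forall>\<sigma>\<in>\<Sigma>. \<forall>\<tau>\<in>\<Sigma>. (\<sigma> \<inter> \<tau>) face_of \<sigma> \<and> (\<sigma> \<inter> \<tau>) face_of \<tau>)"

text \<open>
  A toric variety of dimension \<open>CARD('n)\<close> over the field \<open>'k\<close> is presented by its fan; it is
  glued from the affine charts \<open>U\<^sub>\<sigma> = Spec 'k[\<sigma>\<^sup>\<or> \<inter> M]\<close>.  The phantom parameter
  \<open>'k\<close> enters through the rings of functions on the charts and on the torus.
\<close>

typedef ('k, 'n::finite) toric_variety = "{\<Sigma> :: (real ^ 'n) set set. is_fan \<Sigma>}"
  morphisms fan_of Toric_Variety
proof
  have "convex_cone hull {} = {0 :: real ^ 'n}"
  proof (rule hull_unique)
    show "convex_cone {0 :: real ^ 'n}"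
      by (auto simp: convex_cone_def conic_def)
  next
    fix T :: "(real ^ 'n) set"
    assume "convex_cone T"
    then show "{0} \<subseteq> T"
      by (simp add: convex_cone_contains_0)
  qed simp
  then have "rational_polyhedral_cone {0 :: real ^ 'n}"
    unfolding rational_polyhedral_cone_def by (intro exI[of _ "{}"]) simp
  then show "{{0}} \<in> {\<Sigma> :: (real ^ 'n) set set. is_fan \<Sigma>}"
    by (auto simp: is_fan_def strongly_convex_def face_of_def)
qed

text \<open>
  The torus-invariant prime divisors correspond to the rays of the fan, and are indexed here by
  the primitive lattice generators of these rays.
\<close>

definition rays :: "('k, 'n::finite) toric_variety \<Rightarrow> (int ^ 'n) set" where
  "rays X = {u. Gcd (range (\<lambda>i. u $ i)) = 1 \<and> convex_cone hull {real_vec u} \<in> fan_of X}"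

definition rays_in :: "('k, 'n::finite) toric_variety \<Rightarrow> (real ^ 'n) set \<Rightarrow> (int ^ 'n) set" where
  "rays_in X \<sigma> = {u \<in> rays X. real_vec u \<in> \<sigma>}"

definition maximal_cones :: "('k, 'n::finite) toric_variety \<Rightarrow> (real ^ 'n) set set" where
  "maximal_cones X = {\<sigma> \<in> fan_of X. \<forall>\<tau>\<in>fan_of X. \<sigma> \<subseteq> \<tau> \<longrightarrow> \<tau> = \<sigma>}"

subsection \<open>Rational functions and torus-invariant divisors\<close>

text \<open>
  The group algebra \<open>'k[M]\<close>, the ring of functions on the torus, is \<open>int ^ 'n \<Rightarrow>\<^sub>0 'k\<close>.
  On a nonzero element \<open>\<Sum> c\<^sub>m \<chi>\<^sup>m\<close>, the valuation along the torus-invariant prime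
  divisor of \<open>u\<close> is the minimum of \<open>\<langle>m, u\<rangle>\<close> over the \<open>m\<close> with \<open>c\<^sub>m \<noteq> 0\<close>.
\<close>

definition ord_along :: "int ^ 'n \<Rightarrow> (int ^ 'n \<Rightarrow>\<^sub>0 'k::field) \<Rightarrow> int" where
  "ord_along u f = Min ((\<lambda>m. pairing m u) ` Poly_Mapping.keys f)"

definition coord_ring :: "(real ^ 'n) set \<Rightarrow> (int ^ 'n \<Rightarrow>\<^sub>0 'k::field) set" where
  "coord_ring \<sigma> = {f. \<forall>m\<in>Poly_Mapping.keys f. \<forall>v\<in>\<sigma>. 0 \<le> real_vec m \<bullet> v}"

inductive_set subalgebra_generated ::
    "(int ^ 'n \<Rightarrow>\<^sub>0 'k::field) set \<Rightarrow> (int ^ 'n \<Rightarrow>\<^sub>0 'k) set" for A where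
  const: "Poly_Mapping.single 0 c \<in> subalgebra_generated A"
| gen: "f \<in> A \<Longrightarrow> f \<in> subalgebra_generated A"
| add: "f \<in> subalgebra_generated A \<Longrightarrow> g \<in> subalgebra_generated A \<Longrightarrow>
          f + g \<in> subalgebra_generated A"
| mult: "f \<in> subalgebra_generated A \<Longrightarrow> g \<in> subalgebra_generated A \<Longrightarrow>
          f * g \<in> subalgebra_generated A"

text \<open>The group of torus-invariant Weil divisors, in the multiplicative notation of HOL-Algebra.\<close>

definition TDiv :: "('k, 'n::finite) toric_variety \<Rightarrow> (int ^ 'n \<Rightarrow> int) monoid" where
  "TDiv X = \<lparr>carrier = {D. \<forall>u. u \<notin> rays X \<longrightarrow> D u = 0},
             monoid.mult = (\<lambda>D E u. D u + E u), one = (\<lambda>u. 0)\<rparr>"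

definition div_of ::
    "('k::field, 'n::finite) toric_variety \<Rightarrow> (int ^ 'n \<Rightarrow>\<^sub>0 'k) \<Rightarrow> (int ^ 'n \<Rightarrow> int)" where
  "div_of X f = (\<lambda>u. if u \<in> rays X then ord_along u f else 0)"

text \<open>
  A rational function has a torus-invariant divisor iff it has neither zeros nor poles on the
  torus, that is, iff it is a unit of \<open>'k[M]\<close>.
\<close>

definition principal :: "('k::field, 'n::finite) toric_variety \<Rightarrow> (int ^ 'n \<Rightarrow> int) set" where
  "principal X = {div_of X f | f. f dvd 1}"

text \<open>
  Every Weil divisor is linearly equivalent to a torus-invariant one, so \<open>Cl(X)\<close> is the group of
  torus-invariant divisors modulo linear equivalence.
\<close>

definition Cl :: "('k::field, 'n::finite) toric_variety \<Rightarrow> (int ^ 'n \<Rightarrow> int) set monoid" where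
  "Cl X = TDiv X Mod principal X"

definition div_class ::
    "('k::field, 'n::finite) toric_variety \<Rightarrow> (int ^ 'n \<Rightarrow> int) \<Rightarrow> (int ^ 'n \<Rightarrow> int) set" where
  "div_class X D = principal X #>\<^bsub>TDiv X\<^esub> D"

definition Cl_tor :: "('k::field, 'n::finite) toric_variety \<Rightarrow> (int ^ 'n \<Rightarrow> int) set set" where
  "Cl_tor X = {c \<in> carrier (Cl X). \<exists>k::nat. k \<ge> 1 \<and> c [^]\<^bsub>Cl X\<^esub> k = \<one>\<^bsub>Cl X\<^esub>}"

definition N1 :: "('k::field, 'n::finite) toric_variety \<Rightarrow> (int ^ 'n \<Rightarrow> int) set set monoid" where
  "N1 X = Cl X Mod Cl_tor X"

definition num_class ::
    "('k::field, 'n::finite) toric_variety \<Rightarrow> (int ^ 'n \<Rightarrow> int) set \<Rightarrow> (int ^ 'n \<Rightarrow> int) set set" where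
  "num_class X c = Cl_tor X #>\<^bsub>Cl X\<^esub> c"

subsection \<open>Cartier and ample divisors\<close>

definition cartier ::
    "('k::field, 'n::finite) toric_variety \<Rightarrow> (int ^ 'n \<Rightarrow> int) \<Rightarrow> bool" where
  "cartier X D \<longleftrightarrow> D \<in> carrier (TDiv X) \<and>
     (\<forall>\<sigma>\<in>fan_of X. \<exists>f :: int ^ 'n \<Rightarrow>\<^sub>0 'k. f dvd 1 \<and> (\<forall>u\<in>rays_in X \<sigma>. ord_along u f = D u))"

text \<open>
  The space \<open>H\<^sup>0(X, O(D))\<close> of rational functions \<open>f\<close> with \<open>f = 0\<close> or \<open>div f + D \<ge> 0\<close>;
  as \<open>D\<close> is trivial on the torus, they all lie in \<open>'k[M]\<close>.
\<close>

definition global_sections ::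
    "('k::field, 'n::finite) toric_variety \<Rightarrow> (int ^ 'n \<Rightarrow> int) \<Rightarrow> (int ^ 'n \<Rightarrow>\<^sub>0 'k) set" where
  "global_sections X D = {f. f = 0 \<or> (\<forall>u\<in>rays X. 0 \<le> ord_along u f + D u)}"

text \<open>
  On a complete toric variety, the sections of \<open>O(D)\<close> define a closed embedding into projective
  space iff on every chart \<open>U\<^sub>\<sigma>\<close> of a maximal cone there is a section \<open>s\<close> that is nowhere zero
  on the chart and such that the fractions \<open>t/s\<close>, with \<open>t\<close> a section, generate the ring of
  functions of the chart.  Here \<open>s'\<close> is \<open>1/s\<close>, which exists in \<open>'k[M]\<close> because the torus is
  contained in the chart.
\<close>

definition very_ample ::
    "('k::field, 'n::finite) toric_variety \<Rightarrow> (int ^ 'n \<Rightarrow> int) \<Rightarrow> bool" where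
  "very_ample X D \<longleftrightarrow> cartier X D \<and>
     (\<forall>\<sigma>\<in>maximal_cones X. \<exists>s \<in> global_sections X D. \<exists>s'.
        s * s' = 1 \<and> (\<forall>u\<in>rays_in X \<sigma>. ord_along u s + D u = 0) \<and>
        subalgebra_generated ((\<lambda>t. t * s') ` global_sections X D) = coord_ring \<sigma>)"

text \<open>Ampleness of a torus-invariant \<open>\<rat>\<close>-divisor: some positive multiple is very ample.\<close>

definition ample ::
    "('k::field, 'n::finite) toric_variety \<Rightarrow> (int ^ 'n \<Rightarrow> rat) \<Rightarrow> bool" where
  "ample X D \<longleftrightarrow> (\<exists>n::nat. n \<ge> 1 \<and>
     (\<exists>E. very_ample X E \<and> (\<forall>u. of_nat n * D u = of_int (E u))))"

definition complete_variety :: "('k, 'n::finite) toric_variety \<Rightarrow> bool" where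
  "complete_variety X \<longleftrightarrow> \<Union> (fan_of X) = UNIV"

definition projective :: "('k::field, 'n::finite) toric_variety \<Rightarrow> bool" where
  "projective X \<longleftrightarrow> complete_variety X \<and> (\<exists>D. very_ample X D)"

definition Q_factorial :: "('k::field, 'n::finite) toric_variety \<Rightarrow> bool" where
  "Q_factorial X \<longleftrightarrow>
     (\<forall>D\<in>carrier (TDiv X). \<exists>n::nat. n \<ge> 1 \<and> cartier X (\<lambda>u. int n * D u))"

section \<open>The ample F-signature\<close>

definition mult_of ::
    "('k::field, 'n::finite) toric_variety \<Rightarrow> (int ^ 'n \<Rightarrow> int) set \<Rightarrow> nat \<Rightarrow> nat" where
  "mult_of X c q = card {D \<in> carrier (TDiv X). (\<forall>u\<in>rays X. D u \<in> {0..int q - 1}) \<and>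
                                div_class X D = c [^]\<^bsub>Cl X\<^esub> q}"

definition FS :: "('k::field, 'n::finite) toric_variety \<Rightarrow> (int ^ 'n \<Rightarrow> int) set set set" where
  "FS X = {num_class X c | c. c \<in> carrier (Cl X) \<and> c \<noteq> \<one>\<^bsub>Cl X\<^esub> \<and>
                              (\<exists>e>0. mult_of X c (CHAR('k) ^ e) \<noteq> 0)}"

text \<open>Ampleness depends only on the numerical class.\<close>

definition AFS :: "('k::field, 'n::finite) toric_variety \<Rightarrow> (int ^ 'n \<Rightarrow> int) set set set" where
  "AFS X = {\<epsilon> \<in> FS X. \<exists>c\<in>\<epsilon>. \<exists>E\<in>c. ample X (\<lambda>u. of_int (E u))}"

text \<open>
  A numerical class is a coset of the torsion subgroup: its elements are exactly the classes
  \<open>[E + T]\<close> for \<open>[T]\<close> torsion.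
\<close>

definition mult_num ::
    "('k::field, 'n::finite) toric_variety \<Rightarrow> (int ^ 'n \<Rightarrow> int) set set \<Rightarrow> nat \<Rightarrow> nat" where
  "mult_num X \<epsilon> q = (\<Sum>c\<in>\<epsilon>. mult_of X c q)"

definition alpha ::
    "('k::field, 'n::finite) toric_variety \<Rightarrow> (int ^ 'n \<Rightarrow> int) set set \<Rightarrow> real" where
  "alpha X \<epsilon> = (THE a.
     (\<lambda>e. real (mult_num X \<epsilon> (CHAR('k) ^ e)) - a * real (CHAR('k) ^ e) ^ CARD('n))
       \<in> O(\<lambda>e. real (CHAR('k) ^ e) ^ (CARD('n) - 1)))"

definition ample_F_signature :: "('k::field, 'n::finite) toric_variety \<Rightarrow> real" where
  "ample_F_signature X = (\<Sum>\<epsilon>\<in>AFS X. alpha X \<epsilon>)"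

section \<open>Toric log pairs\<close>

definition canonical_divisor :: "('k, 'n::finite) toric_variety \<Rightarrow> (int ^ 'n \<Rightarrow> int)" where
  "canonical_divisor X = (\<lambda>u. if u \<in> rays X then -1 else 0)"

definition log_canonical_divisor ::
    "('k, 'n::finite) toric_variety \<Rightarrow> (int ^ 'n \<Rightarrow> rat) \<Rightarrow> (int ^ 'n \<Rightarrow> rat)" where
  "log_canonical_divisor X \<Delta> = (\<lambda>u. of_int (canonical_divisor X u) + \<Delta> u)"

definition toric_boundary :: "('k, 'n::finite) toric_variety \<Rightarrow> (int ^ 'n \<Rightarrow> rat) \<Rightarrow> bool" where
  "toric_boundary X \<Delta> \<longleftrightarrow> (\<forall>u\<in>rays X. 0 < \<Delta> u \<and> \<Delta> u \<le> 1) \<and> (\<forall>u. u \<notin> rays X \<longrightarrow> \<Delta> u = 0)"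

text \<open>A toric log pair is KLT iff all its boundary coefficients are less than one.\<close>

definition KLT :: "('k, 'n::finite) toric_variety \<Rightarrow> (int ^ 'n \<Rightarrow> rat) \<Rightarrow> bool" where
  "KLT X \<Delta> \<longleftrightarrow> (\<forall>u\<in>rays X. \<Delta> u < 1)"

definition log_Fano :: "('k::field, 'n::finite) toric_variety \<Rightarrow> (int ^ 'n \<Rightarrow> rat) \<Rightarrow> bool" where
  "log_Fano X \<Delta> \<longleftrightarrow> KLT X \<Delta> \<and> ample X (\<lambda>u. - log_canonical_divisor X \<Delta> u)"

definition Q_lin_equiv ::
    "('k::field, 'n::finite) toric_variety \<Rightarrow> (int ^ 'n \<Rightarrow> rat) \<Rightarrow> (int ^ 'n \<Rightarrow> rat) \<Rightarrow> bool" where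
  "Q_lin_equiv X D D' \<longleftrightarrow> (\<exists>k::nat. k \<ge> 1 \<and>
     (\<exists>P\<in>principal X. \<forall>u. of_nat k * (D u - D' u) = of_int (P u)))"

definition class_index :: "('k::field, 'n::finite) toric_variety \<Rightarrow> (int ^ 'n \<Rightarrow> rat) \<Rightarrow> nat" where
  "class_index X \<Delta> = (LEAST n. n \<ge> 1 \<and> (\<exists>E\<in>carrier (TDiv X).
     Q_lin_equiv X (\<lambda>u. of_nat n * log_canonical_divisor X \<Delta> u) (\<lambda>u. of_int (E u))))"

end

theory Submission
  imports Defs
begin

text \<open>
  Up to torsion, the divisors with coefficients in \<open>{0, \<dots>, q - 1}\<close> that are linearly equivalent
  to \<open>qE\<close> are the points \<open>y\<close> of the lattice \<open>q\<^sup>-\<^sup>1 M\<close> with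
  \<open>0 \<le> \<langle>y, u\<rangle> + E u \<le> 1 - 1/q\<close> for all ray generators \<open>u\<close>.  Completeness of the fan makes the polytope
  \<open>0 \<le> \<langle>y, u\<rangle> + E u \<le> 1\<close> compact, so \<open>\<alpha>(E)\<close> is its volume summed over
  the torsion translates of \<open>E\<close>, and \<open>\<alpha>(E) > 0\<close> iff the polytope has an interior point, which can be taken
  rational.  For a rational interior point \<open>y\<close>, the coefficients
  \<open>\<delta>\<^sub>u = 1 - (\<langle>y, u\<rangle> + E u)\<close> lie strictly between \<open>0\<close> and \<open>1\<close> and
  \<open>- (K + \<Delta>)\<close> is \<open>\<rat>\<close>-linearly equivalent to \<open>E\<close>; conversely a log Fano boundary of
  class index one yields such an \<open>E\<close> and \<open>y\<close>.  Ampleness passes between \<open>E\<close> and \<open>- (K + \<Delta>)\<close>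
  because it is invariant under \<open>\<rat>\<close>-linear equivalence.
\<close>


section \<open>Cones of a fan\<close>

text \<open>Both sides meet in one arithmetic condition on an ample integral divisor
  \<open>E\<close>: for some q >= 1 and some character m, 0 < q E(u) + <m, u> < q for every ray
  generator u. Here q is an arbitrary denominator. On the Fano side it is the multiplier of a
  \<rat>-linear equivalence; on the signature side only powers of p may occur. The volume of the
  polytope bridges the two, since when positive it is detected by every sufficiently fine grid.
  Three obstacles shape the work. Ampleness is stated through very ample embeddings, so its
  invariance under \<rat>-linear equivalence rests on the units of the group algebra being scalar
  multiples of characters. The number \<alpha>(E) is a definite description, so the asymptotic count
  must come with uniqueness of its leading coefficient, and the sums only carry their intended
  meaning once the torsion group and the Frobenius support are finite. The Frobenius support omits
  the zero class, so the class of \<open>E\<close> must be nontrivial; this holds because on a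
  complete fan no character is positive on every ray.\<close>

lemma convex_cone_hull_single: "convex_cone hull {a::'a::real_vector} = {c *\<^sub>R a | c. 0 \<le> c}"
proof (rule hull_unique)
  show "convex_cone {c *\<^sub>R a | c. 0 \<le> c}"
    unfolding convex_cone_iff
    by (force simp flip: scaleR_add_left)
  show "{a} \<subseteq> {c *\<^sub>R a | c. 0 \<le> c}"
    by (auto intro: exI[of _ 1])
next
  fix T assume "{a} \<subseteq> T" "convex_cone T"
  then show "{c *\<^sub>R a | c. 0 \<le> c} \<subseteq> T"
    by (auto intro: convex_cone_scaleR)
qed

lemma convex_cone_hull_insert:
  "convex_cone hull (insert a S) = {x + c *\<^sub>R a | x c. x \<in> convex_cone hull S \<and> 0 \<le> c}"
  using convex_cone_hull_Un[of S "{a}"] by (auto simp: convex_cone_hull_single)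

text \<open>If a point l a of the ray lies inside a segment of the cone, then l a = c + g a with c
  in the cone of \<open>S\<close>. The case g < l would put a into that cone. Otherwise c and -c
  both lie in the whole cone, so strong convexity gives c = 0, and a second use of it removes the
  components of both endpoints coming from \<open>S\<close>.\<close>

lemma extreme_generator_face:
  assumes sc: "strongly_convex (convex_cone hull (insert a S))"
    and a: "a \<notin> convex_cone hull S"
  shows "convex_cone hull {a} face_of convex_cone hull (insert a S)"
proof -
  define K where "K = convex_cone hull S"
  define C where "C = convex_cone hull (insert a S)"
  have C: "C = {x + c *\<^sub>R a | x c. x \<in> K \<and> 0 \<le> c}"
    unfolding C_def K_def by (rule convex_cone_hull_insert)
  have cK: "convex_cone K" and cC: "convex_cone C"
    by (simp_all add: K_def C_def convex_cone_convex_cone_hull)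
  have KC: "K \<subseteq> C" unfolding K_def C_def by (rule hull_mono) auto
  have aC: "a \<in> C" unfolding C_def by (simp add: hull_inc)
  have sc': "v = 0" if "v \<in> C" "- v \<in> C" for v
    using sc that unfolding strongly_convex_def C_def by blast
  have main: "y \<in> convex_cone hull {a} \<and> z \<in> convex_cone hull {a}"
    if y: "y \<in> C" and z: "z \<in> C" and x: "x \<in> convex_cone hull {a}" and seg: "x \<in> open_segment y z" for x y z
  proof -
    obtain y' \<alpha> where y': "y = y' + \<alpha> *\<^sub>R a" "y' \<in> K" "0 \<le> \<alpha>" using y C by auto
    obtain z' \<beta> where z': "z = z' + \<beta> *\<^sub>R a" "z' \<in> K" "0 \<le> \<beta>" using z C by auto
    obtain l where l: "x = l *\<^sub>R a" "0 \<le> l" using x by (auto simp: convex_cone_hull_single)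
    obtain t where t: "0 < t" "t < 1" "x = (1 - t) *\<^sub>R y + t *\<^sub>R z"
      using seg by (auto simp: in_segment)
    define c where "c = (1 - t) *\<^sub>R y' + t *\<^sub>R z'"
    define g where "g = (1 - t) * \<alpha> + t * \<beta>"
    have cin: "c \<in> K" unfolding c_def using cK y' z' t by (intro convex_cone_add convex_cone_scaleR) auto
    have eq: "l *\<^sub>R a = c + g *\<^sub>R a"
      using l t y' z' by (simp add: c_def g_def algebra_simps)
    have "\<not> g < l"
    proof
      assume "g < l"
      have "(l - g) *\<^sub>R a = c" using eq by (simp add: algebra_simps)
      then have "a = (1 / (l - g)) *\<^sub>R c" using \<open>g < l\<close>
        by (metis diff_gt_0_iff_gt divide_inverse_commute eq_vector_fraction_iff less_irrefl mult.right_neutral scaleR_one)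
      moreover have "(1 / (l - g)) *\<^sub>R c \<in> K" using cin cK \<open>g < l\<close> by (intro convex_cone_scaleR) auto
      ultimately show False using a K_def by auto
    qed
    then have "- c = (g - l) *\<^sub>R a" "0 \<le> g - l" using eq by (auto simp: algebra_simps)
    then have "- c \<in> C" using aC cC by (metis convex_cone_scaleR)
    then have c0: "c = 0" using sc' cin KC by auto
    have "- y' = (t / (1 - t)) *\<^sub>R z'"
    proof -
      have "(1 - t) *\<^sub>R (- y') = t *\<^sub>R z'" using c0 by (simp add: c_def algebra_simps add_eq_0_iff)
      then have "(1 / (1 - t)) *\<^sub>R ((1 - t) *\<^sub>R (- y')) = (1 / (1 - t)) *\<^sub>R (t *\<^sub>R z')" by simp
      then show ?thesis using t by simp
    qed
    moreover have "(t / (1 - t)) *\<^sub>R z' \<in> C" using cC z' KC t by (intro convex_cone_scaleR) auto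
    ultimately have "y' = 0" using sc' y' KC by auto
    then have "z' = 0" using c0 t by (auto simp: c_def)
    show ?thesis using \<open>y' = 0\<close> \<open>z' = 0\<close> y' z' by (auto simp: convex_cone_hull_single)
  qed
  have sub: "convex_cone hull {a} \<subseteq> C" unfolding C_def by (rule hull_mono) auto
  show ?thesis
    unfolding face_of_def C_def[symmetric]
    using main sub convex_convex_cone_hull by blast
qed

section \<open>Lattice vectors and primitive ray generators\<close>

lemma real_vec_eq_0_iff [simp]: "real_vec v = 0 \<longleftrightarrow> v = 0"
  by (simp add: real_vec_def vec_eq_iff)

lemma real_vec_0 [simp]: "real_vec 0 = 0"
  by simp

lemma inner_real_vec: "real_vec m \<bullet> real_vec u = real_of_int (pairing m u)"
  by (simp add: real_vec_def pairing_def inner_vec_def)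

lemma primitive_multiple:
  fixes s :: "int ^ 'n::finite"
  assumes "s \<noteq> 0"
  obtains u g where "Gcd (range (($) u)) = 1" "g > 0" "real_vec s = real_of_int g *\<^sub>R real_vec u"
proof -
  define g where "g = Gcd (range (($) s))"
  have g0: "g \<noteq> 0" using assms by (auto simp: g_def vec_eq_iff)
  have "g \<ge> 0" unfolding g_def by (rule Gcd_int_greater_eq_0)
  then have g: "g > 0" using g0 by simp
  have dv: "g dvd s $ i" for i unfolding g_def by (rule Gcd_dvd) simp
  define u where "u = (\<chi> i. s $ i div g)"
  have su: "s $ i = g * u $ i" for i using dv by (simp add: u_def)
  have "range (($) s) = (*) g ` range (($) u)" using su by (auto simp: image_image)
  then have "g = normalize (g * Gcd (range (($) u)))" using Gcd_mult g_def by metis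
  then have "g * 1 = g * Gcd (range (($) u))"
    using g by (simp add: abs_mult Gcd_int_greater_eq_0)
  then have "Gcd (range (($) u)) = 1" using g by simp
  moreover have "real_vec s = real_of_int g *\<^sub>R real_vec u"
    by (simp add: real_vec_def vec_eq_iff su)
  ultimately show thesis using that g by blast
qed

text \<open>Proportionality can be written over the integers as v_i u_j = u_i v_j. Taking the gcd
  over j, with both vectors primitive, gives |v_i| = |u_i|, so the positive factor between the
  vectors is 1. Rays of the fan and elements of \<open>rays X\<close> thus correspond injectively,
  which makes \<open>rays X\<close> finite.\<close>

lemma primitive_ray_unique:
  fixes u v :: "int ^ 'n::finite"
  assumes "Gcd (range (($) u)) = 1" "Gcd (range (($) v)) = 1"
    and "convex_cone hull {real_vec u} = convex_cone hull {real_vec v}"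
  shows "u = v"
proof -
  have "real_vec u \<in> convex_cone hull {real_vec v}" using assms(3) by (metis hull_inc singletonI)
  then obtain c where c: "real_vec u = c *\<^sub>R real_vec v" "c \<ge> 0"
    by (auto simp: convex_cone_hull_single)
  have u0: "u \<noteq> 0" using assms(1) by auto
  have v0: "v \<noteq> 0" using assms(2) by auto
  have ci: "real_of_int (u $ i) = c * real_of_int (v $ i)" for i
    using c(1) by (simp add: real_vec_def vec_eq_iff)
  obtain i where i: "v $ i \<noteq> 0" using v0 by (auto simp: vec_eq_iff)
  have cr: "v $ i * u $ j = u $ i * v $ j" for j
  proof -
    have "real_of_int (v $ i * u $ j) = real_of_int (u $ i * v $ j)"
      by (simp add: ci)
    then show ?thesis by linarith
  qed
  have "(*) (v $ i) ` range (($) u) = (*) (u $ i) ` range (($) v)"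
    using cr by (auto simp: image_image)
  then have "\<bar>v $ i\<bar> = \<bar>u $ i\<bar>" using assms(1,2) Gcd_mult
    by (metis mult.right_neutral normalize_int_def)
  then have "\<bar>real_of_int (v $ i)\<bar> = \<bar>c * real_of_int (v $ i)\<bar>" using ci[of i] by linarith
  then have "c = 1" using i c(2) by (simp add: abs_mult)
  then show ?thesis using ci by (simp add: vec_eq_iff)
qed

lemma is_fan_fan_of: "is_fan (fan_of X)"
  using fan_of[of X] by simp

lemma finite_rays [simp]: "finite (rays X)"
proof (rule finite_imageD)
  show "finite ((\<lambda>u. convex_cone hull {real_vec u}) ` rays X)"
  proof (rule finite_subset)
    show "finite (fan_of X)" using is_fan_fan_of[of X] by (simp only: is_fan_def)
  qed (auto simp: rays_def)
  show "inj_on (\<lambda>u. convex_cone hull {real_vec u}) (rays X)"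
    unfolding inj_on_def rays_def using primitive_ray_unique by blast
qed

lemma zero_notin_rays: "0 \<notin> rays X"
  by (auto simp: rays_def)

text \<open>In a generating set of minimal cardinality every generator spans an extreme ray.\<close>

lemma fan_cone_hull_rays:
  assumes "\<sigma> \<in> fan_of X"
  shows "\<sigma> = convex_cone hull (real_vec ` rays_in X \<sigma>)"
proof -
  have fan: "is_fan (fan_of X)" by (rule is_fan_fan_of)
  have rp: "rational_polyhedral_cone \<sigma>" and sc: "strongly_convex \<sigma>"
    and faces: "\<And>\<tau>. \<tau> face_of \<sigma> \<Longrightarrow> \<tau> \<noteq> {} \<Longrightarrow> \<tau> \<in> fan_of X"
    using fan assms by (auto simp: is_fan_def)
  define gen where "gen S \<longleftrightarrow> finite S \<and> \<sigma> = convex_cone hull (real_vec ` S)" for S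
  obtain S where S: "gen S" and min: "\<And>T. gen T \<Longrightarrow> card S \<le> card T"
    using rp arg_min_nat_lemma[of gen _ card] unfolding rational_polyhedral_cone_def gen_def[symmetric]
    by (metis)
  have "real_vec s \<in> convex_cone hull (real_vec ` rays_in X \<sigma>)" if s: "s \<in> S" for s
  proof -
    define T where "T = real_vec ` (S - {s})"
    have ST: "real_vec ` S = insert (real_vec s) T" using s by (auto simp: T_def)
    \<comment> \<open>A redundant s could be dropped, contradicting the minimal cardinality of
      \<open>S\<close>.\<close>
    have notin: "real_vec s \<notin> convex_cone hull T"
    proof
      assume "real_vec s \<in> convex_cone hull T"
      then have "convex_cone hull (insert (real_vec s) T) = convex_cone hull T"
        by (rule hull_redundant)
      then have "gen (S - {s})" using S ST T_def by (simp add: gen_def)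
      then show False using min[of "S - {s}"] s S card_Diff1_less[of S s] by (auto simp: gen_def)
    qed
    have "convex_cone hull {real_vec s} face_of \<sigma>"
      using extreme_generator_face[OF _ notin] sc S ST by (simp add: gen_def)
    then have f: "convex_cone hull {real_vec s} \<in> fan_of X"
      using faces convex_cone_hull_nonempty by blast
    have "s \<noteq> 0" using notin convex_cone_hull_contains_0[of T] by auto
    then obtain u g where u: "Gcd (range (($) u)) = 1" "g > 0" "real_vec s = real_of_int g *\<^sub>R real_vec u"
      by (rule primitive_multiple)
    have us: "real_vec u = (1 / real_of_int g) *\<^sub>R real_vec s" using u by simp
    have "convex_cone hull {real_vec s} = convex_cone hull {real_vec u}"
    proof (rule subset_antisym; rule hull_minimal)
      show "{real_vec s} \<subseteq> convex_cone hull {real_vec u}"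
        using u by (auto simp: convex_cone_hull_single intro!: exI[of _ "real_of_int g"])
      show "{real_vec u} \<subseteq> convex_cone hull {real_vec s}"
        using u(2) by (auto simp: convex_cone_hull_single us intro!: exI[of _ "1 / real_of_int g"])
    qed (auto simp: convex_cone_convex_cone_hull)
    then have "u \<in> rays X" using f u by (simp add: rays_def)
    moreover have "real_vec u \<in> \<sigma>"
    proof -
      have "real_vec s \<in> \<sigma>" using S s by (auto simp: gen_def hull_inc)
      then have "(1 / real_of_int g) *\<^sub>R real_vec s \<in> \<sigma>"
        using S u(2) by (simp add: gen_def convex_cone_hull_mul)
      then show ?thesis using us by simp
    qed
    ultimately have "real_vec u \<in> convex_cone hull (real_vec ` rays_in X \<sigma>)"
      by (auto simp: rays_in_def intro: hull_inc)
    then show ?thesis using u by (simp add: convex_cone_hull_mul)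
  qed
  then have "convex_cone hull (real_vec ` S) \<subseteq> convex_cone hull (real_vec ` rays_in X \<sigma>)"
    by (intro hull_minimal) (auto simp: convex_cone_convex_cone_hull)
  moreover have "convex_cone hull (real_vec ` rays_in X \<sigma>) \<subseteq> \<sigma>"
    using S by (intro hull_minimal) (auto simp: rays_in_def convex_cone_convex_cone_hull gen_def)
  ultimately show ?thesis using S by (auto simp: gen_def)
qed

section \<open>Consequences of completeness\<close>

lemma complete_hull_rays:
  assumes "complete_variety X"
  shows "convex_cone hull (real_vec ` rays X) = UNIV"
proof -
  have "v \<in> convex_cone hull (real_vec ` rays X)" for v
  proof -
    obtain \<sigma> where \<sigma>: "\<sigma> \<in> fan_of X" "v \<in> \<sigma>" using assms by (auto simp: complete_variety_def)
    then have "v \<in> convex_cone hull (real_vec ` rays_in X \<sigma>)" using fan_cone_hull_rays by blast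
    also have "\<dots> \<subseteq> convex_cone hull (real_vec ` rays X)"
      by (intro hull_mono) (auto simp: rays_in_def)
    finally show ?thesis .
  qed
  then show ?thesis by auto
qed

text \<open>The half-space of w contains all rays, hence the whole space, hence -w. This rules out
  nonzero characters that are nonnegative on every ray.\<close>

lemma complete_nonneg_imp_0:
  assumes "complete_variety X" "\<And>u. u \<in> rays X \<Longrightarrow> 0 \<le> w \<bullet> real_vec u"
  shows "w = 0"
proof -
  have "convex_cone hull (real_vec ` rays X) \<subseteq> {x. w \<bullet> x \<ge> 0}"
    using assms(2) by (intro hull_minimal convex_cone_halfspace_ge) auto
  then have "- w \<in> {x. w \<bullet> x \<ge> 0}" using complete_hull_rays[OF assms(1)] by blast
  then have "w \<bullet> w \<le> 0" by simp
  then show ?thesis using inner_gt_zero_iff[of w] by (simp add: not_less[symmetric])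
qed

text \<open>The directions v along which y . v stays bounded on the set form a subspace. It contains
  the ray generators, whose convex cone is everything, so all coordinates of y are bounded. The
  bound \<open>B\<close> is left free because the polytope and its thickenings both need it.\<close>

lemma complete_bounded_slabs:
  assumes "complete_variety X"
  shows "bounded {y. \<forall>u\<in>rays X. \<bar>y \<bullet> real_vec u\<bar> \<le> B u}" (is "bounded ?S")
proof -
  define T where "T = {v. \<exists>C. \<forall>y\<in>?S. \<bar>y \<bullet> v\<bar> \<le> C}"
  have "subspace T"
  proof (rule subspaceI)
    show "0 \<in> T" by (auto simp: T_def)
  next
    fix v w assume "v \<in> T" "w \<in> T"
    then obtain C D where "\<forall>y\<in>?S. \<bar>y \<bullet> v\<bar> \<le> C" "\<forall>y\<in>?S. \<bar>y \<bullet> w\<bar> \<le> D" unfolding T_def by blast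
    then have "\<forall>y\<in>?S. \<bar>y \<bullet> (v + w)\<bar> \<le> C + D"
      by (auto simp: inner_add_right intro!: abs_triangle_ineq[THEN order_trans] add_mono)
    then show "v + w \<in> T" unfolding T_def by blast
  next
    fix c v assume "v \<in> T"
    then obtain C where "\<forall>y\<in>?S. \<bar>y \<bullet> v\<bar> \<le> C" unfolding T_def by blast
    then have "\<forall>y\<in>?S. \<bar>y \<bullet> (c *\<^sub>R v)\<bar> \<le> \<bar>c\<bar> * C"
      by (auto simp: abs_mult intro!: mult_left_mono)
    then show "c *\<^sub>R v \<in> T" unfolding T_def by blast
  qed
  then have "convex_cone hull (real_vec ` rays X) \<subseteq> T"
    by (intro hull_minimal subspace_imp_convex_cone) (auto simp: T_def)
  then have "T = UNIV" using complete_hull_rays[OF assms] by auto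
  then have "\<forall>v. \<exists>C. \<forall>y\<in>?S. \<bar>y \<bullet> v\<bar> \<le> C" unfolding T_def by blast
  from choice[OF this] obtain C where C: "\<And>v y. y \<in> ?S \<Longrightarrow> \<bar>y \<bullet> v\<bar> \<le> C v" by blast
  have "norm y \<le> (\<Sum>b\<in>Basis. C b)" if "y \<in> ?S" for y
    using order_trans[OF norm_le_l1[of y] sum_mono[of Basis "\<lambda>b. \<bar>y \<bullet> b\<bar>" C]] C[OF that] by blast
  then show ?thesis unfolding bounded_iff by blast
qed

section \<open>Units of the group algebra and ampleness\<close>

lemma pairing_add_left: "pairing (a + b) u = pairing a u + pairing b u"
  and pairing_diff_left: "pairing (a - b) u = pairing a u - pairing b u"
  and pairing_minus_left: "pairing (- a) u = - pairing a u"
  and pairing_add_right: "pairing u (a + b) = pairing u a + pairing u b"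
  and pairing_minus_right: "pairing u (- a) = - pairing u a"
  and pairing_zero_left: "pairing 0 u = 0"
  and pairing_scale_left: "pairing (k *s a) u = k * pairing a u"
  and pairing_scale_right: "pairing u (k *s a) = k * pairing u a"
  by (simp_all add: pairing_def algebra_simps sum.distrib sum_subtractf sum_negf sum_distrib_left)

lemma pairing_self_eq_0_iff: "pairing v v = 0 \<longleftrightarrow> v = 0"
  unfolding pairing_def by (subst sum_nonneg_eq_0_iff) (auto simp: vec_eq_iff)

text \<open>A lexicographic combination k w + v: the factor k exceeds every |<s, v>|, so a nonzero
  value <s, w> cannot be cancelled. The only new vector on which w may vanish is v itself, and there
  <v, v> > 0 takes over.\<close>

lemma separating_functional:
  fixes S :: "(int ^ 'n::finite) set"
  assumes "finite S" "0 \<notin> S"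
  shows "\<exists>w. \<forall>v\<in>S. pairing v w \<noteq> 0"
  using assms
proof (induction S rule: finite_induct)
  case (insert v S)
  then obtain w where w: "\<forall>s\<in>S. pairing s w \<noteq> 0" by auto
  define k where "k = 1 + (\<Sum>s\<in>insert v S. \<bar>pairing s v\<bar>)"
  have k: "\<bar>pairing s v\<bar> < k" if "s \<in> insert v S" for s
  proof -
    have "\<bar>pairing s v\<bar> \<le> (\<Sum>s\<in>insert v S. \<bar>pairing s v\<bar>)"
      by (rule member_le_sum) (use that insert.hyps(1) in simp_all)
    then show ?thesis unfolding k_def by linarith
  qed
  have dominant: "k * x + y \<noteq> 0" if "x \<noteq> 0" "\<bar>y\<bar> < k" for x y :: int
  proof
    assume "k * x + y = 0"
    then have "y = - (k * x)" by linarith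
    then have "\<bar>y\<bar> = \<bar>k\<bar> * \<bar>x\<bar>" by (simp add: abs_mult)
    moreover have "\<bar>k\<bar> * 1 \<le> \<bar>k\<bar> * \<bar>x\<bar>" using that by (intro mult_left_mono) auto
    ultimately show False using that by linarith
  qed
  have "pairing s (k *s w + v) \<noteq> 0" if s: "s \<in> insert v S" for s
  proof (cases "pairing s w = 0")
    case True
    then have "s = v" using w s by auto
    then show ?thesis using True insert.prems
      by (simp add: pairing_add_right pairing_scale_right pairing_self_eq_0_iff)
  next
    case False
    then show ?thesis using dominant k[OF s] by (simp add: pairing_add_right pairing_scale_right)
  qed
  then show ?case by blast
qed simp

text \<open>Split off the monomials \<open>f1\<close> of f at a and \<open>g1\<close> of g at b.
  Neither (f - f1) g nor f1 (g - g1) has a term at a + b, so only the product of the two monomials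
  contributes.\<close>

lemma lookup_mult_unique:
  fixes f g :: "int ^ 'n::finite \<Rightarrow>\<^sub>0 'k::field"
  assumes u: "\<And>a' b'. a' \<in> Poly_Mapping.keys f \<Longrightarrow> b' \<in> Poly_Mapping.keys g \<Longrightarrow> a' + b' = a + b \<Longrightarrow> a' = a \<and> b' = b"
  shows "Poly_Mapping.lookup (f * g) (a + b) = Poly_Mapping.lookup f a * Poly_Mapping.lookup g b"
proof -
  define f1 where "f1 = Poly_Mapping.single a (Poly_Mapping.lookup f a)"
  define g1 where "g1 = Poly_Mapping.single b (Poly_Mapping.lookup g b)"
  have f': "Poly_Mapping.keys (f - f1) \<subseteq> Poly_Mapping.keys f - {a}"
    by (auto simp: in_keys_iff lookup_minus f1_def lookup_single when_def split: if_splits)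
  have g': "Poly_Mapping.keys (g - g1) \<subseteq> Poly_Mapping.keys g - {b}"
    by (auto simp: in_keys_iff lookup_minus g1_def lookup_single when_def split: if_splits)
  have "Poly_Mapping.lookup ((f - f1) * g) (a + b) = 0"
  proof -
    have "a + b \<notin> Poly_Mapping.keys ((f - f1) * g)"
    proof
      assume "a + b \<in> Poly_Mapping.keys ((f - f1) * g)"
      then obtain x y where "a + b = x + y" "x \<in> Poly_Mapping.keys (f - f1)" "y \<in> Poly_Mapping.keys g"
        using keys_mult[of "f - f1" g] by auto
      then show False using f' u[of x y] by (metis Diff_iff singletonI subsetD)
    qed
    then show ?thesis by (simp add: in_keys_iff)
  qed
  moreover have "Poly_Mapping.lookup (f1 * (g - g1)) (a + b) = 0"
  proof -
    have "a + b \<notin> Poly_Mapping.keys (f1 * (g - g1))"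
    proof
      assume "a + b \<in> Poly_Mapping.keys (f1 * (g - g1))"
      then obtain x y where "a + b = x + y" "x \<in> Poly_Mapping.keys f1" "y \<in> Poly_Mapping.keys (g - g1)"
        using keys_mult[of f1 "g - g1"] by auto
      moreover then have "x = a" by (simp add: f1_def split: if_splits)
      ultimately show False using g' by auto
    qed
    then show ?thesis by (simp add: in_keys_iff)
  qed
  moreover have "f * g = (f - f1) * g + (f1 * (g - g1) + f1 * g1)"
    by (simp add: algebra_simps)
  moreover have "Poly_Mapping.lookup (f1 * g1) (a + b) = Poly_Mapping.lookup f a * Poly_Mapping.lookup g b"
    by (simp add: f1_def g1_def mult_single)
  ultimately show ?thesis by (simp add: lookup_add)
qed

lemma extremal_key_mult:
  fixes f g :: "int ^ 'n::finite \<Rightarrow>\<^sub>0 'k::field"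
  assumes a: "a \<in> Poly_Mapping.keys f" "\<And>x. x \<in> Poly_Mapping.keys f \<Longrightarrow> x \<noteq> a \<Longrightarrow> pairing a w < pairing x w"
    and b: "b \<in> Poly_Mapping.keys g" "\<And>x. x \<in> Poly_Mapping.keys g \<Longrightarrow> x \<noteq> b \<Longrightarrow> pairing b w < pairing x w"
  shows "a + b \<in> Poly_Mapping.keys (f * g)"
proof -
  have "a' = a \<and> b' = b"
    if "a' \<in> Poly_Mapping.keys f" "b' \<in> Poly_Mapping.keys g" and eq: "a' + b' = a + b" for a' b'
  proof -
    have "pairing a' w + pairing b' w = pairing a w + pairing b w"
      by (metis eq pairing_add_left)
    then show ?thesis using a(2)[OF that(1)] b(2)[OF that(2)] by (cases "a' = a"; cases "b' = b") auto
  qed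
  then have "Poly_Mapping.lookup (f * g) (a + b) = Poly_Mapping.lookup f a * Poly_Mapping.lookup g b"
    by (rule lookup_mult_unique)
  then show ?thesis using a(1) b(1) by (simp add: in_keys_iff)
qed

lemma unique_min_key:
  fixes f :: "int ^ 'n::finite \<Rightarrow>\<^sub>0 'k::field"
  assumes "f \<noteq> 0" "inj_on (\<lambda>m. pairing m w) (Poly_Mapping.keys f)"
  obtains a where "a \<in> Poly_Mapping.keys f"
    "\<And>x. x \<in> Poly_Mapping.keys f \<Longrightarrow> x \<noteq> a \<Longrightarrow> pairing a w < pairing x w"
proof -
  let ?K = "Poly_Mapping.keys f"
  have ne: "?K \<noteq> {}" using assms(1) by simp
  define a where "a = arg_min_on (\<lambda>m. pairing m w) ?K"
  have "a \<in> ?K" unfolding a_def using ne by (intro arg_min_if_finite) auto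
  moreover have "pairing a w < pairing x w" if "x \<in> ?K" "x \<noteq> a" for x
  proof -
    have "pairing a w \<le> pairing x w" unfolding a_def using ne that by (intro arg_min_least) auto
    moreover have "pairing a w \<noteq> pairing x w" using assms(2) that \<open>a \<in> ?K\<close> by (auto simp: inj_on_def)
    ultimately show ?thesis by simp
  qed
  ultimately show thesis by (rule that)
qed

text \<open>
  For a functional \<open>w\<close> separating the exponents, both the sum of the minimal exponents of \<open>f\<close> and \<open>g\<close> and
  the sum of the maximal ones occur in \<open>f * g = 1\<close>, so both are \<open>0\<close> and the minima equal the maxima.
\<close>

lemma monomial_of_unit:
  fixes f g :: "int ^ 'n::finite \<Rightarrow>\<^sub>0 'k::field"
  assumes fg: "f * g = 1"
  obtains m c where "c \<noteq> 0" "f = Poly_Mapping.single m c" "g = Poly_Mapping.single (- m) (inverse c)"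
proof -
  let ?K = "Poly_Mapping.keys f" and ?L = "Poly_Mapping.keys g"
  \<comment> \<open>All nonzero differences of exponents: a functional without zeros on
    \<open>S\<close> is injective on the support of each factor, so the extremal exponents are
    unique.\<close>
  define S where "S = ((\<lambda>(a, b). a - b) ` (?K \<times> ?K) \<union> (\<lambda>(a, b). a - b) ` (?L \<times> ?L)) - {0}"
  have "finite S" "0 \<notin> S" by (auto simp: S_def)
  then obtain w where w: "\<And>v. v \<in> S \<Longrightarrow> pairing v w \<noteq> 0" using separating_functional by metis
  have nz: "f \<noteq> 0" "g \<noteq> 0" using fg by auto
  have injK: "inj_on (\<lambda>m. pairing m w) ?K"
  proof (rule inj_onI, rule ccontr)
    fix x y assume "x \<in> ?K" "y \<in> ?K" "pairing x w = pairing y w" "x \<noteq> y"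
    moreover then have "x - y \<in> S" by (auto simp: S_def)
    ultimately show False using w[of "x - y"] by (simp add: pairing_diff_left)
  qed
  have injL: "inj_on (\<lambda>m. pairing m w) ?L"
  proof (rule inj_onI, rule ccontr)
    fix x y assume "x \<in> ?L" "y \<in> ?L" "pairing x w = pairing y w" "x \<noteq> y"
    moreover then have "x - y \<in> S" by (auto simp: S_def)
    ultimately show False using w[of "x - y"] by (simp add: pairing_diff_left)
  qed
  \<comment> \<open>Passing to -w turns the statement on minimal exponents into the one on maximal
    exponents.\<close>
  have injK': "inj_on (\<lambda>m. pairing m (- w)) ?K" and injL': "inj_on (\<lambda>m. pairing m (- w)) ?L"
    using injK injL by (auto simp: inj_on_def pairing_minus_right)
  obtain a where a: "a \<in> ?K" "\<And>x. x \<in> ?K \<Longrightarrow> x \<noteq> a \<Longrightarrow> pairing a w < pairing x w"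
    using unique_min_key[OF nz(1) injK] by blast
  obtain b where b: "b \<in> ?L" "\<And>x. x \<in> ?L \<Longrightarrow> x \<noteq> b \<Longrightarrow> pairing b w < pairing x w"
    using unique_min_key[OF nz(2) injL] by blast
  obtain a' where a': "a' \<in> ?K" "\<And>x. x \<in> ?K \<Longrightarrow> x \<noteq> a' \<Longrightarrow> pairing a' (- w) < pairing x (- w)"
    using unique_min_key[OF nz(1) injK'] by blast
  obtain b' where b': "b' \<in> ?L" "\<And>x. x \<in> ?L \<Longrightarrow> x \<noteq> b' \<Longrightarrow> pairing b' (- w) < pairing x (- w)"
    using unique_min_key[OF nz(2) injL'] by blast
  have one: "Poly_Mapping.keys (1 :: int ^ 'n \<Rightarrow>\<^sub>0 'k) = {0}" by simp
  have "a + b = 0" using extremal_key_mult[OF a b] unfolding fg one by simp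
  have "a' + b' = 0" using extremal_key_mult[OF a' b'] unfolding fg one by simp
  have "pairing a w + pairing b w = 0" "pairing a' w + pairing b' w = 0"
    using \<open>a + b = 0\<close> \<open>a' + b' = 0\<close> by (metis pairing_add_left pairing_zero_left)+
  moreover have "a' \<noteq> a \<Longrightarrow> pairing a w < pairing a' w" "b' \<noteq> b \<Longrightarrow> pairing b w < pairing b' w"
    using a(2)[OF a'(1)] b(2)[OF b'(1)] by auto
  \<comment> \<open>Both sums of values are 0, while a maximum different from its minimum would make
    the second sum strictly larger.\<close>
  ultimately have eq: "a' = a" "b' = b" by fastforce+
  have K: "?K = {a}"
  proof -
    have "x = a" if "x \<in> ?K" for x
      using a(2)[OF that] a'(2)[OF that] by (cases "x = a") (simp_all add: eq pairing_minus_right)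
    then show ?thesis using a(1) by blast
  qed
  have L: "?L = {b}"
  proof -
    have "x = b" if "x \<in> ?L" for x
      using b(2)[OF that] b'(2)[OF that] by (cases "x = b") (simp_all add: eq pairing_minus_right)
    then show ?thesis using b(1) by blast
  qed
  define c d where "c = Poly_Mapping.lookup f a" and "d = Poly_Mapping.lookup g b"
  have f: "f = Poly_Mapping.single a c"
  proof (rule poly_mapping_eqI)
    fix x show "Poly_Mapping.lookup f x = Poly_Mapping.lookup (Poly_Mapping.single a c) x"
      using K in_keys_iff[of x f] by (auto simp: c_def lookup_single when_def)
  qed
  have g: "g = Poly_Mapping.single b d"
  proof (rule poly_mapping_eqI)
    fix x show "Poly_Mapping.lookup g x = Poly_Mapping.lookup (Poly_Mapping.single b d) x"
      using L in_keys_iff[of x g] by (auto simp: d_def lookup_single when_def)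
  qed
  have "c \<noteq> 0" using a(1) by (simp add: c_def in_keys_iff)
  have e: "Poly_Mapping.single 0 (c * d) = (1 :: int ^ 'n \<Rightarrow>\<^sub>0 'k)"
    using fg \<open>a + b = 0\<close> by (simp add: f g mult_single)
  have "c * d = Poly_Mapping.lookup (Poly_Mapping.single (0 :: int ^ 'n) (c * d)) 0" by simp
  also have "\<dots> = 1" unfolding e by (simp add: lookup_one)
  finally have "c * d = 1" .
  then have "d = inverse c" using inverse_unique[of c d] by simp
  moreover have "b = - a" using \<open>a + b = 0\<close> by (simp add: add_eq_0_iff)
  ultimately show thesis using that[OF \<open>c \<noteq> 0\<close> f] g by simp
qed

lemma single_mult_inverse:
  fixes m :: "int ^ 'n::finite"
  assumes "(c::'k::field) \<noteq> 0"
  shows "Poly_Mapping.single m c * Poly_Mapping.single (- m) (inverse c) = 1"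
  using assms by (simp add: mult_single)

lemma unit_iff_monomial:
  fixes f :: "int ^ 'n::finite \<Rightarrow>\<^sub>0 'k::field"
  shows "f dvd 1 \<longleftrightarrow> (\<exists>m c. c \<noteq> 0 \<and> f = Poly_Mapping.single m c)"
proof
  assume "f dvd 1"
  then obtain g where "f * g = 1" by (metis dvd_def)
  then show "\<exists>m c. c \<noteq> 0 \<and> f = Poly_Mapping.single m c" by (rule monomial_of_unit) auto
next
  assume "\<exists>m c. c \<noteq> 0 \<and> f = Poly_Mapping.single m c"
  then show "f dvd 1" using single_mult_inverse by (metis dvdI)
qed

lemma ord_along_single [simp]: "c \<noteq> 0 \<Longrightarrow> ord_along u (Poly_Mapping.single m c) = pairing m u"
  by (simp add: ord_along_def)

section \<open>Divisors, sections and very ampleness in terms of characters\<close>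

definition char_div :: "('k, 'n::finite) toric_variety \<Rightarrow> int ^ 'n \<Rightarrow> int ^ 'n \<Rightarrow> int" where
  "char_div X m = (\<lambda>u. if u \<in> rays X then pairing m u else 0)"

text \<open>Units are scalar multiples of characters, and the scalar does not affect the order along
  a divisor.\<close>

lemma principal_eq: "principal (X :: ('k::field, 'n::finite) toric_variety) = range (char_div X)"
proof -
  have "div_of X (Poly_Mapping.single m c) = char_div X m" if "c \<noteq> 0" for m and c :: 'k
    using that by (auto simp: div_of_def char_div_def)
  then show ?thesis
    unfolding principal_def unit_iff_monomial
    by (auto simp: image_def) (metis zero_neq_one)+
qed

lemma cartier_iff:
  "cartier (X :: ('k::field, 'n::finite) toric_variety) D \<longleftrightarrow> D \<in> carrier (TDiv X) \<and>
     (\<forall>\<sigma>\<in>fan_of X. \<exists>m. \<forall>u\<in>rays_in X \<sigma>. pairing m u = D u)"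
proof -
  have "(\<exists>f :: int ^ 'n \<Rightarrow>\<^sub>0 'k. f dvd 1 \<and> (\<forall>u\<in>U. ord_along u f = D u)) \<longleftrightarrow>
      (\<exists>m. \<forall>u\<in>U. pairing m u = D u)" for U
    unfolding unit_iff_monomial
  proof safe
    fix m assume "\<forall>u\<in>U. pairing m u = D u"
    then show "\<exists>f :: int ^ 'n \<Rightarrow>\<^sub>0 'k. (\<exists>m c. c \<noteq> 0 \<and> f = Poly_Mapping.single m c) \<and> (\<forall>u\<in>U. ord_along u f = D u)"
      by (intro exI[of _ "Poly_Mapping.single m 1"] conjI exI[of _ m] exI[of _ "1::'k"] ballI) simp_all
  qed auto
  then show ?thesis unfolding cartier_def by simp
qed

text \<open>The lattice points of the section polytope of \<open>D\<close>: exactly the exponents of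
  its monomial sections.\<close>

definition sect_chars :: "('k, 'n::finite) toric_variety \<Rightarrow> (int ^ 'n \<Rightarrow> int) \<Rightarrow> (int ^ 'n) set" where
  "sect_chars X D = {m. \<forall>u\<in>rays X. 0 \<le> pairing m u + D u}"

lemma global_sections_eq:
  "global_sections (X :: ('k::field, 'n::finite) toric_variety) D =
     {f. Poly_Mapping.keys f \<subseteq> sect_chars X D}"
proof -
  have "f = 0 \<or> (\<forall>u\<in>rays X. 0 \<le> ord_along u f + D u) \<longleftrightarrow> Poly_Mapping.keys f \<subseteq> sect_chars X D"
    for f :: "int ^ 'n \<Rightarrow>\<^sub>0 'k"
  proof (cases "f = 0")
    case False
    have flip: "0 \<le> a + b \<longleftrightarrow> - b \<le> a" for a b :: int by linarith
    have "- D u \<le> ord_along u f \<longleftrightarrow> (\<forall>m\<in>Poly_Mapping.keys f. - D u \<le> pairing m u)" for u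
      unfolding ord_along_def using False by (subst Min_ge_iff) auto
    then show ?thesis using False by (auto simp: sect_chars_def flip)
  qed simp
  then show ?thesis unfolding global_sections_def by simp
qed

text \<open>A section invertible in the group algebra is a monomial with some exponent m, and
  dividing by it shifts all exponents by -m. The scalar drops out because the set of sections is
  stable under rescaling.\<close>

lemma very_ample_iff:
  "very_ample (X :: ('k::field, 'n::finite) toric_variety) D \<longleftrightarrow> cartier X D \<and>
     (\<forall>\<sigma>\<in>maximal_cones X. \<exists>m\<in>sect_chars X D. (\<forall>u\<in>rays_in X \<sigma>. pairing m u + D u = 0) \<and>
        subalgebra_generated {f :: int ^ 'n \<Rightarrow>\<^sub>0 'k. \<forall>a\<in>Poly_Mapping.keys f. a + m \<in> sect_chars X D}
          = coord_ring \<sigma>)"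
proof -
  have im: "(\<lambda>t. t * Poly_Mapping.single (- m) (inverse c)) ` global_sections X D =
      {f :: int ^ 'n \<Rightarrow>\<^sub>0 'k. \<forall>a\<in>Poly_Mapping.keys f. a + m \<in> sect_chars X D}" (is "?L = ?R")
    if "c \<noteq> 0" for m and c :: 'k
  proof
    show "?L \<subseteq> ?R"
    proof safe
      fix t :: "int ^ 'n \<Rightarrow>\<^sub>0 'k" and a
      assume t: "t \<in> global_sections X D" and "a \<in> Poly_Mapping.keys (t * Poly_Mapping.single (- m) (inverse c))"
      then obtain b where "b \<in> Poly_Mapping.keys t" "a = b + - m"
        using keys_mult[of t "Poly_Mapping.single (- m) (inverse c)"] by (auto split: if_splits)
      then show "a + m \<in> sect_chars X D" using t by (auto simp: global_sections_eq)
    qed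
    show "?R \<subseteq> ?L"
    proof
      fix f assume f: "f \<in> ?R"
      have "f = (f * Poly_Mapping.single m c) * Poly_Mapping.single (- m) (inverse c)"
        using single_mult_inverse[OF that, of m] by (simp add: mult.assoc)
      moreover have "f * Poly_Mapping.single m c \<in> global_sections X D"
        using keys_mult[of f "Poly_Mapping.single m c"] f by (auto simp: global_sections_eq split: if_splits)
      ultimately show "f \<in> ?L" by blast
    qed
  qed
  have "(\<exists>s \<in> global_sections X D. \<exists>s'. s * s' = 1 \<and> (\<forall>u\<in>rays_in X \<sigma>. ord_along u s + D u = 0) \<and>
        subalgebra_generated ((\<lambda>t. t * s') ` global_sections X D) = coord_ring \<sigma>) \<longleftrightarrow>
      (\<exists>m\<in>sect_chars X D. (\<forall>u\<in>rays_in X \<sigma>. pairing m u + D u = 0) \<and>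
        subalgebra_generated {f :: int ^ 'n \<Rightarrow>\<^sub>0 'k. \<forall>a\<in>Poly_Mapping.keys f. a + m \<in> sect_chars X D}
          = coord_ring \<sigma>)" (is "?A \<longleftrightarrow> ?B") for \<sigma>
  proof
    assume ?A
    then obtain s s' where s: "s \<in> global_sections X D" "s * s' = 1"
      "\<forall>u\<in>rays_in X \<sigma>. ord_along u s + D u = 0"
      "subalgebra_generated ((\<lambda>t. t * s') ` global_sections X D) = coord_ring \<sigma>" by auto
    obtain m c where m: "c \<noteq> 0" "s = Poly_Mapping.single m c" "s' = Poly_Mapping.single (- m) (inverse c)"
      using s(2) by (rule monomial_of_unit)
    have "m \<in> sect_chars X D" using s(1) m by (simp add: global_sections_eq)
    then show ?B using s(3,4) m im[OF m(1), of m] by auto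
  next
    assume ?B
    then obtain m where m: "m \<in> sect_chars X D" "\<forall>u\<in>rays_in X \<sigma>. pairing m u + D u = 0"
      "subalgebra_generated {f :: int ^ 'n \<Rightarrow>\<^sub>0 'k. \<forall>a\<in>Poly_Mapping.keys f. a + m \<in> sect_chars X D}
          = coord_ring \<sigma>" by auto
    have "Poly_Mapping.single m (1::'k) \<in> global_sections X D" using m(1) by (simp add: global_sections_eq)
    then show ?A using m im[of 1 m] single_mult_inverse[of "1::'k" m]
      by (intro bexI[of _ "Poly_Mapping.single m 1"] exI[of _ "Poly_Mapping.single (- m) (inverse 1)"]) auto
  qed
  then show ?thesis unfolding very_ample_def by simp
qed

text \<open>A cone of the fan is generated by its rays, so a linear form is nonnegative on it as
  soon as it is so on the ray generators.\<close>

lemma coord_ring_iff: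
  fixes X :: "('k::field, 'n::finite) toric_variety"
  assumes "\<sigma> \<in> fan_of X"
  shows "(f :: int ^ 'n \<Rightarrow>\<^sub>0 'k) \<in> coord_ring \<sigma> \<longleftrightarrow> (\<forall>m\<in>Poly_Mapping.keys f. \<forall>u\<in>rays_in X \<sigma>. 0 \<le> pairing m u)"
proof -
  have "(\<forall>v\<in>\<sigma>. 0 \<le> real_vec m \<bullet> v) \<longleftrightarrow> (\<forall>u\<in>rays_in X \<sigma>. 0 \<le> pairing m u)" for m :: "int ^ 'n"
  proof
    assume "\<forall>v\<in>\<sigma>. 0 \<le> real_vec m \<bullet> v"
    then show "\<forall>u\<in>rays_in X \<sigma>. 0 \<le> pairing m u"
      by (auto simp: rays_in_def inner_real_vec)
  next
    assume "\<forall>u\<in>rays_in X \<sigma>. 0 \<le> pairing m u"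
    then have "convex_cone hull (real_vec ` rays_in X \<sigma>) \<subseteq> {x. real_vec m \<bullet> x \<ge> 0}"
      by (intro hull_minimal convex_cone_halfspace_ge) (auto simp: inner_real_vec)
    then show "\<forall>v\<in>\<sigma>. 0 \<le> real_vec m \<bullet> v" using fan_cone_hull_rays[OF assms] by auto
  qed
  then show ?thesis unfolding coord_ring_def by simp
qed

lemma subalgebra_generated_mono:
  assumes "A \<subseteq> B" shows "subalgebra_generated A \<subseteq> subalgebra_generated B"
proof
  fix f assume "f \<in> subalgebra_generated A"
  then show "f \<in> subalgebra_generated B"
    using assms by (induction rule: subalgebra_generated.induct) (auto intro: subalgebra_generated.intros)
qed

lemma subalgebra_generated_coord_ring:
  fixes X :: "('k::field, 'n::finite) toric_variety"
  assumes "\<sigma> \<in> fan_of X" "A \<subseteq> (coord_ring \<sigma> :: (int ^ 'n \<Rightarrow>\<^sub>0 'k) set)"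
  shows "subalgebra_generated A \<subseteq> coord_ring \<sigma>"
proof
  fix f assume "f \<in> subalgebra_generated A"
  then show "f \<in> coord_ring \<sigma>"
  proof (induction rule: subalgebra_generated.induct)
    case (const c)
    then show ?case by (simp add: coord_ring_iff[OF assms(1)] pairing_zero_left)
  next
    case (gen f)
    then show ?case using assms by auto
  next
    case (add f g)
    then show ?case using Poly_Mapping.keys_add[of f g] unfolding coord_ring_iff[OF assms(1)] by blast
  next
    case (mult f g)
    then show ?case using keys_mult[of f g] unfolding coord_ring_iff[OF assms(1)]
      by (fastforce simp: pairing_add_left)
  qed
qed

text \<open>If m is the exponent trivializing \<open>D\<close> on a maximal cone, then N m - a does
  so for the new divisor, and its slack <m', u> + D'(u) on each ray is N times the old one. As the
  old slack is nonnegative and N >= 1, every exponent admissible before remains admissible, so the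
  generated algebra can only grow; it stays inside the coordinate ring because the slack vanishes on
  the rays of the cone.\<close>

lemma very_ample_multiple_add_principal:
  fixes X :: "('k::field, 'n::finite) toric_variety"
  assumes va: "very_ample X D" and N: "N \<ge> (1::nat)"
  shows "very_ample X (\<lambda>u. int N * D u + char_div X a u)"
proof -
  define D' where "D' = (\<lambda>u. int N * D u + char_div X a u)"
  have c: "cartier X D" using va by (simp add: very_ample_def)
  have "cartier X D'"
    unfolding cartier_iff
  proof (intro conjI ballI)
    show "D' \<in> carrier (TDiv X)" using c by (auto simp: cartier_def TDiv_def D'_def char_div_def)
    fix \<sigma> assume "\<sigma> \<in> fan_of X"
    then obtain m where "\<forall>u\<in>rays_in X \<sigma>. pairing m u = D u" using c unfolding cartier_iff by auto
    then have "\<forall>u\<in>rays_in X \<sigma>. pairing (int N *s m + a) u = D' u"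
      by (auto simp: D'_def char_div_def rays_in_def pairing_add_left pairing_scale_left)
    then show "\<exists>m. \<forall>u\<in>rays_in X \<sigma>. pairing m u = D' u" by blast
  qed
  moreover have "\<exists>m\<in>sect_chars X D'. (\<forall>u\<in>rays_in X \<sigma>. pairing m u + D' u = 0) \<and>
        subalgebra_generated {f :: int ^ 'n \<Rightarrow>\<^sub>0 'k. \<forall>a\<in>Poly_Mapping.keys f. a + m \<in> sect_chars X D'}
          = coord_ring \<sigma>" if max: "\<sigma> \<in> maximal_cones X" for \<sigma>
  proof -
    have \<sigma>: "\<sigma> \<in> fan_of X" using max by (simp add: maximal_cones_def)
    obtain m where m: "m \<in> sect_chars X D" "\<forall>u\<in>rays_in X \<sigma>. pairing m u + D u = 0"
      and gen: "subalgebra_generated {f :: int ^ 'n \<Rightarrow>\<^sub>0 'k. \<forall>a\<in>Poly_Mapping.keys f. a + m \<in> sect_chars X D}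
          = coord_ring \<sigma>" (is "subalgebra_generated ?S = _")
      using bspec[OF conjunct2[OF iffD1[OF very_ample_iff va]] max] by (elim bexE conjE)
    define m' where "m' = int N *s m - a"
    let ?S' = "{f :: int ^ 'n \<Rightarrow>\<^sub>0 'k. \<forall>a\<in>Poly_Mapping.keys f. a + m' \<in> sect_chars X D'}"
    have pm: "pairing m' u + D' u = int N * (pairing m u + D u)" if "u \<in> rays X" for u
      using that by (simp add: m'_def D'_def char_div_def pairing_diff_left pairing_scale_left algebra_simps)
    have nonneg: "pairing m u + D u \<ge> 0" if "u \<in> rays X" for u
      using m(1) that by (simp add: sect_chars_def)
    have "m' \<in> sect_chars X D'"
      unfolding sect_chars_def using pm nonneg by auto
    moreover have z: "\<forall>u\<in>rays_in X \<sigma>. pairing m' u + D' u = 0"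
      using pm m(2) by (auto simp: rays_in_def)
    moreover have "?S \<subseteq> ?S'"
    proof safe
      fix f :: "int ^ 'n \<Rightarrow>\<^sub>0 'k" and b
      assume f: "\<forall>a\<in>Poly_Mapping.keys f. a + m \<in> sect_chars X D" and b: "b \<in> Poly_Mapping.keys f"
      have "0 \<le> pairing (b + m') u + D' u" if u: "u \<in> rays X" for u
      proof -
        have "0 \<le> pairing b u + (pairing m u + D u)" using f b u by (auto simp: sect_chars_def pairing_add_left add.assoc)
        also have "\<dots> \<le> pairing b u + int N * (pairing m u + D u)"
          using nonneg[OF u] N mult_right_mono[of 1 "int N" "pairing m u + D u"] by auto
        finally show ?thesis using pm[OF u] by (simp add: pairing_add_left)
      qed
      then show "b + m' \<in> sect_chars X D'" by (simp add: sect_chars_def)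
    qed
    then have "coord_ring \<sigma> \<subseteq> subalgebra_generated ?S'"
      using gen subalgebra_generated_mono by blast
    moreover have "subalgebra_generated ?S' \<subseteq> coord_ring \<sigma>"
    proof (rule subalgebra_generated_coord_ring[OF \<sigma>])
      show "?S' \<subseteq> coord_ring \<sigma>"
      proof
        fix f assume f: "f \<in> ?S'"
        have "0 \<le> pairing b u" if "b \<in> Poly_Mapping.keys f" "u \<in> rays_in X \<sigma>" for b u
        proof -
          have "0 \<le> pairing b u + (pairing m' u + D' u)"
            using f that by (auto simp: sect_chars_def rays_in_def pairing_add_left add.assoc)
          then show ?thesis using z that by simp
        qed
        then show "f \<in> coord_ring \<sigma>" unfolding coord_ring_iff[OF \<sigma>] by blast
      qed
    qed
    ultimately show ?thesis by (intro bexI[of _ m'] conjI subset_antisym)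
  qed
  ultimately show ?thesis unfolding very_ample_iff D'_def by simp
qed

text \<open>Clearing both denominators: with n A = E very ample, n k B equals k E plus the divisor
  of the n-th power of the character m.\<close>

lemma ample_Q_lin_equiv:
  fixes X :: "('k::field, 'n::finite) toric_variety"
  assumes "ample X A" "k \<ge> (1::nat)" "\<And>u. of_nat k * (B u - A u) = of_int (char_div X m u)"
  shows "ample X B"
proof -
  obtain n E where n: "n \<ge> (1::nat)" "very_ample X E" "\<And>u. of_nat n * A u = of_int (E u)"
    using assms(1) unfolding ample_def by blast
  have "very_ample X (\<lambda>u. int k * E u + char_div X (int n *s m) u)"
    using very_ample_multiple_add_principal[OF n(2) assms(2)] .
  moreover have "of_nat (n * k) * B u = of_int (int k * E u + char_div X (int n *s m) u)" for u
  proof -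
    have "of_nat (n * k) * B u = of_nat k * (of_nat n * A u) + of_nat n * (of_nat k * (B u - A u))"
      by (simp add: algebra_simps)
    also have "\<dots> = of_int (int k * E u + int n * char_div X m u)" by (simp add: assms(3) n(3))
    also have "int n * char_div X m u = char_div X (int n *s m) u"
      by (simp add: char_div_def pairing_scale_left)
    finally show ?thesis .
  qed
  moreover have "n * k \<ge> 1" using n assms(2) by simp
  ultimately show ?thesis unfolding ample_def by blast
qed

section \<open>Lattice points between parallel hyperplanes\<close>

text \<open>About \<open>1/\<epsilon>\<close> translates of the slab in direction \<open>u\<close> are disjoint and fit into one larger ball.\<close>

lemma measure_slab_le:
  fixes u :: "'a::euclidean_space"
  assumes u: "u \<noteq> 0"
  shows "\<exists>C\<ge>0. \<forall>b \<epsilon>. \<epsilon> > 0 \<longrightarrow> measure lebesgue {z \<in> cball 0 r. \<bar>z \<bullet> u - b\<bar> \<le> \<epsilon>} \<le> C * \<epsilon>"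
proof -
  \<comment> \<open>The translates below move by at most K * 3\<epsilon> / |u| <= 3 / |u|, hence the
    enlarged radius.\<close>
  define Big where "Big = cball (0::'a) (r + 3 / norm u)"
  define V where "V = measure lebesgue Big"
  have Big: "Big \<in> lmeasurable" unfolding Big_def by (intro lmeasurable_compact compact_cball)
  have V0: "V \<ge> 0" by (simp add: V_def)
  have "measure lebesgue {z \<in> cball 0 r. \<bar>z \<bullet> u - b\<bar> \<le> \<epsilon>} \<le> 2 * V * \<epsilon>" if \<epsilon>: "\<epsilon> > 0" for b \<epsilon>
  proof -
    define S where "S = {z \<in> cball 0 r. \<bar>z \<bullet> u - b\<bar> \<le> \<epsilon>}"
    have "closed {z. \<bar>z \<bullet> u - b\<bar> \<le> \<epsilon>}" by (intro closed_Collect_le continuous_intros)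
    then have "compact (cball 0 r \<inter> {z. \<bar>z \<bullet> u - b\<bar> \<le> \<epsilon>})" by (rule compact_Int_closed[OF compact_cball])
    then have S: "S \<in> lmeasurable"
      unfolding S_def by (intro lmeasurable_compact) (simp add: Int_def)
    have "measure lebesgue S \<le> 2 * V * \<epsilon>"
    proof (cases "\<epsilon> \<ge> 1")
      case True
      have "S \<subseteq> Big" by (auto simp: S_def Big_def intro!: add_increasing2)
      then have "measure lebesgue S \<le> V"
        unfolding V_def using S Big by (intro measure_mono_fmeasurable) auto
      also have "\<dots> \<le> 2 * V * \<epsilon>" using V0 True mult_left_mono[of 1 "2 * \<epsilon>" V] by (simp add: ac_simps)
      finally show ?thesis .
    next
      case False
      \<comment> \<open>Rounding 1/\<epsilon> >= 1 down loses at most a factor 2; this is the 2 in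
        the constant 2 \<open>V\<close>.\<close>
      define K where "K = nat \<lfloor>1 / \<epsilon>\<rfloor>"
      have K: "1 \<le> K" "real K \<le> 1 / \<epsilon>" "1 / \<epsilon> \<le> 2 * real K"
      proof -
        have ge: "1 \<le> 1 / \<epsilon>" using False \<epsilon> by simp
        then have f: "1 \<le> \<lfloor>1 / \<epsilon>\<rfloor>" by simp
        then have iK: "int K = \<lfloor>1 / \<epsilon>\<rfloor>" unfolding K_def by linarith
        then have rK: "1 \<le> K" "real K = real_of_int \<lfloor>1 / \<epsilon>\<rfloor>"
          using f by (linarith, simp flip: iK)
        then show "1 \<le> K" "real K \<le> 1 / \<epsilon>" "1 / \<epsilon> \<le> 2 * real K" by linarith+
      qed
      \<comment> \<open>One step shifts the value of z . u by 3\<epsilon>, more than the width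
        2\<epsilon> of the slab, so distinct translates are disjoint.\<close>
      define v where "v = (3 * \<epsilon> / (u \<bullet> u)) *\<^sub>R u"
      have vu: "v \<bullet> u = 3 * \<epsilon>" using u by (simp add: v_def)
      have nv: "norm v = 3 * \<epsilon> / norm u"
        using u \<epsilon> by (simp add: v_def dot_square_norm power2_eq_square)
      define T where "T k = (+) (real k *\<^sub>R v) ` S" for k
      have T: "T k \<in> lmeasurable" for k unfolding T_def by (rule measurable_translation[OF S])
      have mT: "measure lebesgue (T k) = measure lebesgue S" for k unfolding T_def by (rule measure_translation)
      have disj: "disjoint_family_on T {..<K}"
        unfolding disjoint_family_on_def
      proof (intro ballI impI, rule ccontr)
        fix k l assume "k \<noteq> l" "T k \<inter> T l \<noteq> {}"
        then obtain z z' where z: "z \<in> S" "z' \<in> S" "real k *\<^sub>R v + z = real l *\<^sub>R v + z'"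
          unfolding T_def by auto
        have "(real k *\<^sub>R v + z) \<bullet> u = (real l *\<^sub>R v + z') \<bullet> u" using z(3) by simp
        then have "z' \<bullet> u - z \<bullet> u = (real k - real l) * (3 * \<epsilon>)"
          by (simp add: inner_add_left vu algebra_simps)
        then have "\<bar>z' \<bullet> u - z \<bullet> u\<bar> = \<bar>real k - real l\<bar> * (3 * \<epsilon>)" using \<epsilon> by (simp add: abs_mult)
        moreover have "\<bar>z' \<bullet> u - z \<bullet> u\<bar> \<le> 2 * \<epsilon>" using z(1,2) unfolding S_def by auto
        moreover have "1 * (3 * \<epsilon>) \<le> \<bar>real k - real l\<bar> * (3 * \<epsilon>)"
          using \<open>k \<noteq> l\<close> \<epsilon> by (intro mult_right_mono) (auto simp: abs_if)
        ultimately show False using \<epsilon> by linarith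
      qed
      have sub: "(\<Union>k<K. T k) \<subseteq> Big"
      proof safe
        fix x k assume k: "k < K" and "x \<in> T k"
        then obtain z where z: "z \<in> S" "x = real k *\<^sub>R v + z" by (auto simp: T_def)
        have "norm x \<le> real k * norm v + norm z" using z norm_triangle_ineq[of "real k *\<^sub>R v" z] by simp
        also have "norm z \<le> r" using z by (auto simp: S_def)
        also have "real k * norm v \<le> (1 / \<epsilon>) * (3 * \<epsilon> / norm u)"
          unfolding nv using k K(2) \<epsilon> by (intro mult_right_mono) auto
        also have "\<dots> = 3 / norm u" using \<epsilon> by simp
        finally show "x \<in> Big" by (simp add: Big_def add.commute)
      qed
      have "real K * measure lebesgue S = (\<Sum>k<K. measure lebesgue (T k))" by (simp add: mT)
      also have "\<dots> = measure lebesgue (\<Union>k<K. T k)"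
      proof (rule measure_finite_Union[symmetric])
        show "T ` {..<K} \<subseteq> sets lebesgue" using T by auto
        show "emeasure lebesgue (T k) \<noteq> \<infinity>" for k
          using fmeasurableD2[OF T[of k]] by simp
      qed (use disj in simp_all)
      also have "\<dots> \<le> V"
        unfolding V_def using sub T Big by (intro measure_mono_fmeasurable) auto
      finally have *: "real K * measure lebesgue S \<le> V" .
      have "(1 / \<epsilon>) * measure lebesgue S \<le> 2 * (real K * measure lebesgue S)"
        using K(3) mult_right_mono[OF K(3), of "measure lebesgue S"] by simp
      also have "\<dots> \<le> 2 * V" using * by simp
      finally show ?thesis using \<epsilon> by (simp add: field_simps)
    qed
    then show ?thesis by (simp add: S_def)
  qed
  then show ?thesis using V0 by (intro exI[of _ "2 * V"]) simp
qed

section \<open>Comparing the volume of a slab polytope with its lattice points\<close>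

definition unit_slabs :: "(int ^ 'n) set \<Rightarrow> (int ^ 'n \<Rightarrow> int) \<Rightarrow> (real ^ 'n) set" where
  "unit_slabs R E = {y. \<forall>u\<in>R. 0 \<le> y \<bullet> real_vec u + real_of_int (E u) \<and> y \<bullet> real_vec u + real_of_int (E u) \<le> 1}"

text \<open>These are numerators: m stands for the point m/q. Since the quantities are integers, the
  bound q - 1 says that m/q lies strictly below the upper hyperplane.\<close>

definition scaled_lattice_points :: "(int ^ 'n) set \<Rightarrow> (int ^ 'n \<Rightarrow> int) \<Rightarrow> nat \<Rightarrow> (int ^ 'n) set" where
  "scaled_lattice_points R E q =
     {m. \<forall>u\<in>R. 0 \<le> int q * E u + pairing m u \<and> int q * E u + pairing m u \<le> int q - 1}"

text \<open>The numerator of the lower corner of the half-open grid cube of side 1/q that contains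
  z.\<close>

definition floor_vec :: "nat \<Rightarrow> real ^ 'n \<Rightarrow> int ^ 'n" where
  "floor_vec q z = (\<chi> i. \<lfloor>real q * z $ i\<rfloor>)"

lemma floor_vec_inner:
  fixes z :: "real ^ 'n::finite" and u :: "int ^ 'n"
  assumes "q \<ge> 1"
  shows "\<bar>z \<bullet> real_vec u - real_of_int (pairing (floor_vec q z) u) / real q\<bar>
     \<le> real_of_int (\<Sum>i\<in>UNIV. \<bar>u $ i\<bar>) / real q"
proof -
  have "real q * (z \<bullet> real_vec u) - real_of_int (pairing (floor_vec q z) u) =
      (\<Sum>i\<in>UNIV. (real q * z $ i - real_of_int \<lfloor>real q * z $ i\<rfloor>) * real_of_int (u $ i))"
    by (simp add: inner_vec_def real_vec_def pairing_def floor_vec_def sum_distrib_left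
        sum_subtractf algebra_simps)
  also have "\<bar>\<dots>\<bar> \<le> (\<Sum>i\<in>UNIV. 1 * \<bar>real_of_int (u $ i)\<bar>)"
  proof (rule order_trans[OF sum_abs], rule sum_mono)
    fix i :: 'n
    have "\<bar>real q * z $ i - real_of_int \<lfloor>real q * z $ i\<rfloor>\<bar> \<le> 1" by linarith
    then show "\<bar>(real q * z $ i - real_of_int \<lfloor>real q * z $ i\<rfloor>) * real_of_int (u $ i)\<bar> \<le> 1 * \<bar>real_of_int (u $ i)\<bar>"
      unfolding abs_mult by (rule mult_right_mono) simp
  qed
  finally have *: "\<bar>real q * (z \<bullet> real_vec u) - real_of_int (pairing (floor_vec q z) u)\<bar>
      \<le> real_of_int (\<Sum>i\<in>UNIV. \<bar>u $ i\<bar>)" by simp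
  have q: "real q > 0" using assms by simp
  have "z \<bullet> real_vec u - real_of_int (pairing (floor_vec q z) u) / real q =
      (real q * (z \<bullet> real_vec u) - real_of_int (pairing (floor_vec q z) u)) / real q"
    using q by (simp add: field_simps)
  then show ?thesis using * q by (simp add: abs_divide divide_right_mono)
qed

text \<open>The fiber is a half-open cube of side 1/q; it differs from the closed box only inside
  the frontier of the latter, which is negligible.\<close>

lemma floor_vec_fiber:
  fixes m :: "int ^ 'n::finite"
  assumes q: "q \<ge> 1"
  shows "floor_vec q -` {m} \<in> lmeasurable"
    and "measure lebesgue (floor_vec q -` {m}) = (1 / real q) ^ CARD('n)"
proof -
  define a b :: "real ^ 'n" where "a = (\<chi> i. real_of_int (m $ i) / real q)" and "b = (\<chi> i. (real_of_int (m $ i) + 1) / real q)"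
  have q0: "real q > 0" using q by simp
  have F: "z \<in> floor_vec q -` {m} \<longleftrightarrow> (\<forall>i. a $ i \<le> z $ i \<and> z $ i < b $ i)" for z
    using q0 by (auto simp: floor_vec_def vec_eq_iff floor_eq_iff a_def b_def field_simps)
  have "box a b \<subseteq> floor_vec q -` {m}" "floor_vec q -` {m} \<subseteq> cbox a b"
    unfolding subset_iff F mem_box_cart by (auto intro: less_imp_le)
  then have "(cbox a b - floor_vec q -` {m}) \<union> (floor_vec q -` {m} - cbox a b) \<subseteq> cbox a b - box a b"
    by auto
  then have neg: "negligible ((cbox a b - floor_vec q -` {m}) \<union> (floor_vec q -` {m} - cbox a b))"
    using negligible_frontier_interval negligible_subset by blast
  show "floor_vec q -` {m} \<in> lmeasurable"
    by (rule lmeasurable_negligible_symdiff[OF lmeasurable_cbox neg])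
  have "a $ i \<le> b $ i" for i using q0 by (simp add: a_def b_def divide_right_mono)
  then have "cbox a b \<noteq> {}" by (auto simp: interval_ne_empty_cart)
  have "measure lebesgue (floor_vec q -` {m}) = measure lebesgue (cbox a b)"
    by (rule measure_negligible_symdiff[OF lmeasurable_cbox neg])
  also have "\<dots> = (\<Prod>i\<in>UNIV. b $ i - a $ i)"
    using content_cbox_cart[OF \<open>cbox a b \<noteq> {}\<close>] by simp
  also have "\<dots> = (1 / real q) ^ CARD('n)" by (simp add: a_def b_def flip: diff_divide_distrib)
  finally show "measure lebesgue (floor_vec q -` {m}) = (1 / real q) ^ CARD('n)" .
qed

lemma finite_bounded_int_vec: "finite {m :: int ^ 'n::finite. \<forall>i. \<bar>m $ i\<bar> \<le> N}"
proof (rule finite_imageD)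
  have "- N \<le> m $ i \<and> m $ i \<le> N" if "\<forall>i. \<bar>m $ i\<bar> \<le> N" for m :: "int ^ 'n" and i
    using that[rule_format, of i] by linarith
  then have "(($) ` {m :: int ^ 'n. \<forall>i. \<bar>m $ i\<bar> \<le> N}) \<subseteq>
      {f. \<forall>x. (x \<in> UNIV \<longrightarrow> f x \<in> {-N..N}) \<and> (x \<notin> UNIV \<longrightarrow> f x = 0)}"
    by auto
  then show "finite (($) ` {m :: int ^ 'n. \<forall>i. \<bar>m $ i\<bar> \<le> N})"
    by (rule finite_subset) (rule finite_set_of_finite_funs, auto)
  show "inj_on ($) {m :: int ^ 'n. \<forall>i. \<bar>m $ i\<bar> \<le> N}" by (auto simp: inj_on_def vec_eq_iff)
qed

text \<open>This keeps from a complete fan only what the count needs: finitely many nonzero normals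
  whose slabs are bounded for every choice of widths.\<close>

locale bounded_slab_family =
  fixes R :: "(int ^ 'n::finite) set"
  assumes finite_R: "finite R" and zero_notin: "0 \<notin> R"
    and bounded_slabs: "\<And>B. bounded {y. \<forall>u\<in>R. \<bar>y \<bullet> real_vec u\<bar> \<le> B u}"
begin

lemma compact_unit_slabs: "compact (unit_slabs R E)"
  unfolding compact_eq_bounded_closed
proof
  have "unit_slabs R E \<subseteq> {y. \<forall>u\<in>R. \<bar>y \<bullet> real_vec u\<bar> \<le> \<bar>real_of_int (E u)\<bar> + 1}"
  proof safe
    fix y u assume "y \<in> unit_slabs R E" "u \<in> R"
    then have "0 \<le> y \<bullet> real_vec u + real_of_int (E u)" "y \<bullet> real_vec u + real_of_int (E u) \<le> 1"
      by (auto simp: unit_slabs_def)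
    then show "\<bar>y \<bullet> real_vec u\<bar> \<le> \<bar>real_of_int (E u)\<bar> + 1" by linarith
  qed
  then show "bounded (unit_slabs R E)" by (rule bounded_subset[OF bounded_slabs])
  have "unit_slabs R E = (\<Inter>u\<in>R. {y. 0 \<le> y \<bullet> real_vec u + real_of_int (E u)} \<inter> {y. y \<bullet> real_vec u + real_of_int (E u) \<le> 1})"
    unfolding unit_slabs_def by auto
  moreover have "closed \<dots>"
    by (intro closed_INT ballI closed_Int closed_Collect_le continuous_intros)
  ultimately show "closed (unit_slabs R E)" by simp
qed

lemma scaled_lattice_point_inner:
  assumes "q \<ge> 1" "m \<in> scaled_lattice_points R E q" "u \<in> R"
  shows "0 \<le> real_of_int (pairing m u) / real q + real_of_int (E u)"
    "real_of_int (pairing m u) / real q + real_of_int (E u) \<le> 1 - 1 / real q"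
proof -
  have "0 \<le> int q * E u + pairing m u" "int q * E u + pairing m u \<le> int q - 1"
    using assms by (auto simp: scaled_lattice_points_def)
  then have "real_of_int 0 \<le> real_of_int (int q * E u + pairing m u)"
    "real_of_int (int q * E u + pairing m u) \<le> real_of_int (int q - 1)"
    by (simp_all only: of_int_le_iff)
  then have "0 / real q \<le> real_of_int (int q * E u + pairing m u) / real q"
    "real_of_int (int q * E u + pairing m u) / real q \<le> (real q - 1) / real q"
    using assms(1) by (intro divide_right_mono; simp)+
  moreover have "real_of_int (int q * E u + pairing m u) / real q = real_of_int (pairing m u) / real q + real_of_int (E u)"
    "(real q - 1) / real q = 1 - 1 / real q"
    using assms(1) by (simp_all add: field_simps)
  ultimately show "0 \<le> real_of_int (pairing m u) / real q + real_of_int (E u)"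
    "real_of_int (pairing m u) / real q + real_of_int (E u) \<le> 1 - 1 / real q"
    by simp_all
qed

text \<open>Each m/q lies in the compact polytope, so the coordinates of m are at most q times a
  bound of its norm.\<close>

lemma finite_scaled_lattice_points:
  assumes "q \<ge> 1"
  shows "finite (scaled_lattice_points R E q)"
proof -
  obtain B where B: "\<And>y. y \<in> unit_slabs R E \<Longrightarrow> norm y \<le> B"
    using compact_imp_bounded[OF compact_unit_slabs] unfolding bounded_iff by blast
  have "scaled_lattice_points R E q \<subseteq> {m. \<forall>i. \<bar>m $ i\<bar> \<le> \<lceil>real q * B\<rceil>}"
  proof safe
    fix m i assume m: "m \<in> scaled_lattice_points R E q"
    define y where "y = (1 / real q) *\<^sub>R real_vec m"
    have "y \<in> unit_slabs R E"
      unfolding unit_slabs_def mem_Collect_eq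
    proof (intro ballI)
      fix u assume "u \<in> R"
      moreover have "1 / real q \<ge> 0" by simp
      moreover have "y \<bullet> real_vec u = real_of_int (pairing m u) / real q" by (simp add: y_def inner_real_vec)
      ultimately show "0 \<le> y \<bullet> real_vec u + real_of_int (E u) \<and> y \<bullet> real_vec u + real_of_int (E u) \<le> 1"
        using scaled_lattice_point_inner[OF assms m, of u] by linarith
    qed
    then have "norm (y $ i) \<le> B" using B Finite_Cartesian_Product.norm_nth_le order_trans by blast
    then have "\<bar>real_of_int (m $ i)\<bar> \<le> real q * B"
      using assms by (simp add: y_def real_vec_def abs_mult field_simps)
    then show "\<bar>m $ i\<bar> \<le> \<lceil>real q * B\<rceil>" by linarith
  qed
  then show ?thesis by (rule finite_subset) (rule finite_bounded_int_vec)
qed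

text \<open>
  The cubes of side \<open>1/q\<close> attached to the lattice points have union \<open>U\<close>; it differs from the polytope
  only in slabs of width \<open>O(1/q)\<close> along the bounding hyperplanes.
\<close>

lemma card_scaled_lattice_points:
  "\<exists>C. \<forall>q\<ge>1. \<bar>real (card (scaled_lattice_points R E q)) - measure lebesgue (unit_slabs R E) * real q ^ CARD('n)\<bar>
      \<le> C * real q ^ (CARD('n) - 1)"
proof -
  define L where "L u = real_of_int (\<Sum>i\<in>UNIV. \<bar>u $ i\<bar>)" for u :: "int ^ 'n"
  have L0: "L u \<ge> 0" for u by (simp add: L_def sum_nonneg)
  \<comment> \<open>A bounded region, independent of q, that contains the polytope and all attached
    cubes: a point of a cube deviates from its corner by at most L u / q <= L u in direction
    u.\<close>
  define W where "W = {z. \<forall>u\<in>R. \<bar>z \<bullet> real_vec u\<bar> \<le> \<bar>real_of_int (E u)\<bar> + 1 + L u}"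
  have "bounded W" unfolding W_def by (rule bounded_slabs)
  then obtain r where r: "W \<subseteq> cball 0 r" by (auto simp: bounded_iff subset_iff)
  have "\<forall>u\<in>R. \<exists>C\<ge>0. \<forall>b \<epsilon>. \<epsilon> > 0 \<longrightarrow> measure lebesgue {z \<in> cball 0 r. \<bar>z \<bullet> real_vec u - b\<bar> \<le> \<epsilon>} \<le> C * \<epsilon>"
  proof
    fix u assume "u \<in> R"
    then have "real_vec u \<noteq> 0" using zero_notin by auto
    then show "\<exists>C\<ge>0. \<forall>b \<epsilon>. \<epsilon> > 0 \<longrightarrow> measure lebesgue {z \<in> cball 0 r. \<bar>z \<bullet> real_vec u - b\<bar> \<le> \<epsilon>} \<le> C * \<epsilon>"
      by (rule measure_slab_le)
  qed
  from bchoice[OF this] obtain C where C: "\<And>u. u \<in> R \<Longrightarrow> C u \<ge> 0"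
    "\<And>u b \<epsilon>. u \<in> R \<Longrightarrow> \<epsilon> > 0 \<Longrightarrow> measure lebesgue {z \<in> cball 0 r. \<bar>z \<bullet> real_vec u - b\<bar> \<le> \<epsilon>} \<le> C u * \<epsilon>"
    by blast
  \<comment> \<open>The factor 2 counts the two hyperplanes bounding the slab of u.\<close>
  define D where "D = (\<Sum>u\<in>R. 2 * C u * (L u + 1))"
  let ?P = "unit_slabs R E"
  have P: "?P \<in> lmeasurable" by (rule lmeasurable_compact[OF compact_unit_slabs])
  have PW: "?P \<subseteq> W"
  proof
    fix z assume z: "z \<in> ?P"
    have "\<bar>z \<bullet> real_vec u\<bar> \<le> \<bar>real_of_int (E u)\<bar> + 1 + L u" if u: "u \<in> R" for u
    proof -
      have "0 \<le> z \<bullet> real_vec u + real_of_int (E u)" "z \<bullet> real_vec u + real_of_int (E u) \<le> 1"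
        using z u by (auto simp: unit_slabs_def)
      then show ?thesis using L0[of u] by linarith
    qed
    then show "z \<in> W" by (simp add: W_def)
  qed
  have main: "\<bar>real (card (scaled_lattice_points R E q)) - measure lebesgue ?P * real q ^ CARD('n)\<bar>
      \<le> D * real q ^ (CARD('n) - 1)" if q: "q \<ge> 1" for q
  proof -
    have q0: "real q > 0" using q by simp
    let ?A = "scaled_lattice_points R E q"
    define U where "U = (\<Union>m\<in>?A. floor_vec q -` {m} :: (real ^ 'n) set)"
    have mU: "measure lebesgue U = real (card ?A) * (1 / real q) ^ CARD('n)"
    proof -
      have "measure lebesgue U = (\<Sum>m\<in>?A. measure lebesgue (floor_vec q -` {m} :: (real ^ 'n) set))"
        unfolding U_def
      proof (rule measure_finite_Union)
        show "finite ?A" by (rule finite_scaled_lattice_points[OF q])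
        show "(\<lambda>m. floor_vec q -` {m}) ` ?A \<subseteq> sets lebesgue" using floor_vec_fiber(1)[OF q] by auto
        show "disjoint_family_on (\<lambda>m. floor_vec q -` {m} :: (real ^ 'n) set) ?A"
          by (auto simp: disjoint_family_on_def)
        show "emeasure lebesgue (floor_vec q -` {m} :: (real ^ 'n) set) \<noteq> \<infinity>" for m
          using fmeasurableD2[OF floor_vec_fiber(1)[OF q, of m]] by simp
      qed
      then show ?thesis by (simp add: floor_vec_fiber(2)[OF q])
    qed
    have U: "U \<in> lmeasurable"
      unfolding U_def using floor_vec_fiber(1)[OF q] finite_scaled_lattice_points[OF q]
      by (intro fmeasurable.finite_UN) auto
    have near: "\<bar>z \<bullet> real_vec u - real_of_int (pairing (floor_vec q z) u) / real q\<bar> \<le> L u / real q" for z u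
      unfolding L_def by (rule floor_vec_inner[OF q])
    have Lq: "L u / real q \<le> L u" for u
    proof -
      have "L u * 1 \<le> L u * real q" using L0[of u] q by (intro mult_left_mono) auto
      then show ?thesis using q0 by (simp add: divide_le_eq)
    qed
    have zU: "z \<in> U \<longleftrightarrow> floor_vec q z \<in> ?A" for z by (auto simp: U_def)
    have UW: "U \<subseteq> W"
    proof
      fix z assume "z \<in> U"
      then have A: "floor_vec q z \<in> ?A" by (simp add: zU)
      have q1: "1 / real q > 0" using q0 by simp
      have "\<bar>z \<bullet> real_vec u\<bar> \<le> \<bar>real_of_int (E u)\<bar> + 1 + L u" if "u \<in> R" for u
        using scaled_lattice_point_inner[OF q A that] near[of z u] Lq[of u] q1 by linarith
      then show "z \<in> W" by (simp add: W_def)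
    qed
    \<comment> \<open>The half-width has two sources: L u / q is the deviation within a cube, and
      the extra 1/q accounts for lattice points being stopped at 1 - 1/q while the polytope reaches
      1.\<close>
    define sl where "sl = (\<lambda>(u, j). {z \<in> cball (0 :: real ^ 'n) r. \<bar>z \<bullet> real_vec u - (j - real_of_int (E u))\<bar> \<le> (L u + 1) / real q})"
    define S where "S = (\<Union>x\<in>R \<times> {0, 1}. sl x)"
    have sl: "sl x \<in> lmeasurable" for x
    proof -
      obtain u j where x: "x = (u, j)" by (cases x)
      have "closed {z. \<bar>z \<bullet> real_vec u - (j - real_of_int (E u))\<bar> \<le> (L u + 1) / real q}"
        by (intro closed_Collect_le continuous_intros)
      then have "compact (cball 0 r \<inter> {z. \<bar>z \<bullet> real_vec u - (j - real_of_int (E u))\<bar> \<le> (L u + 1) / real q})"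
        by (rule compact_Int_closed[OF compact_cball])
      then show ?thesis unfolding x sl_def by (intro lmeasurable_compact) (simp add: Int_def)
    qed
    have S: "S \<in> lmeasurable" unfolding S_def using finite_R sl by (intro fmeasurable.finite_UN) auto
    have mS: "measure lebesgue S \<le> D / real q"
    proof -
      have "measure lebesgue S \<le> (\<Sum>x\<in>R \<times> {0, 1}. measure lebesgue (sl x))"
        unfolding S_def using finite_R sl by (intro measure_UNION_le) auto
      also have "\<dots> \<le> (\<Sum>x\<in>R \<times> {0, 1::real}. C (fst x) * ((L (fst x) + 1) / real q))"
      proof (rule sum_mono)
        fix x :: "(int ^ 'n) \<times> real" assume "x \<in> R \<times> {0, 1}"
        then obtain u j where x: "x = (u, j)" "u \<in> R" by auto
        have "(L u + 1) / real q > 0" using L0[of u] q0 by simp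
        from C(2)[OF x(2) this, of "j - real_of_int (E u)"]
        show "measure lebesgue (sl x) \<le> C (fst x) * ((L (fst x) + 1) / real q)"
          by (simp only: x(1) sl_def prod.case fst_conv)
      qed
      also have "\<dots> = (\<Sum>u\<in>R. \<Sum>j\<in>{0, 1::real}. C u * ((L u + 1) / real q))"
        unfolding sum.cartesian_product case_prod_beta ..
      also have "\<dots> = D / real q" unfolding D_def sum_divide_distrib by (intro sum.cong) auto
      finally show ?thesis .
    qed
    have inS: "z \<in> S" if "u \<in> R" "z \<in> W" "\<bar>z \<bullet> real_vec u - (j - real_of_int (E u))\<bar> \<le> (L u + 1) / real q" "j = 0 \<or> j = 1" for z u j
      using that r unfolding S_def sl_def by fastforce
    have split: "(L u + 1) / real q = L u / real q + 1 / real q" for u by (simp add: add_divide_distrib)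
    have "U \<subseteq> ?P \<union> S"
    proof
      fix z assume z: "z \<in> U"
      then have A: "floor_vec q z \<in> ?A" by (simp add: zU)
      show "z \<in> ?P \<union> S"
      proof (cases "z \<in> ?P")
        case False
        then obtain u where u: "u \<in> R" and viol: "z \<bullet> real_vec u + real_of_int (E u) < 0 \<or> z \<bullet> real_vec u + real_of_int (E u) > 1"
          unfolding unit_slabs_def by force
        have q1: "1 / real q > 0" using q0 by simp
        note facts = scaled_lattice_point_inner[OF q A u] near[of z u] q1 split[of u]
        from viol have "z \<in> S"
        proof
          assume "z \<bullet> real_vec u + real_of_int (E u) < 0"
          with facts have "\<bar>z \<bullet> real_vec u - (0 - real_of_int (E u))\<bar> \<le> (L u + 1) / real q" by linarith
          then show ?thesis using inS[OF u] z UW by blast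
        next
          assume "z \<bullet> real_vec u + real_of_int (E u) > 1"
          with facts have "\<bar>z \<bullet> real_vec u - (1 - real_of_int (E u))\<bar> \<le> (L u + 1) / real q" by linarith
          then show ?thesis using inS[OF u] z UW by blast
        qed
        then show ?thesis by simp
      qed simp
    qed
    then have "measure lebesgue U \<le> measure lebesgue (?P \<union> S)"
      using U P S by (intro measure_mono_fmeasurable) auto
    also have "\<dots> \<le> measure lebesgue ?P + measure lebesgue S" using P S by (intro measure_Un_le) auto
    finally have le1: "measure lebesgue U \<le> measure lebesgue ?P + D / real q" using mS by linarith
    have "?P \<subseteq> U \<union> S"
    proof
      fix z assume z: "z \<in> ?P"
      show "z \<in> U \<union> S"
      proof (cases "floor_vec q z \<in> ?A")
        case False
        then obtain u where u: "u \<in> R" and viol: "int q * E u + pairing (floor_vec q z) u < 0 \<or> int q * E u + pairing (floor_vec q z) u > int q - 1"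
          unfolding scaled_lattice_points_def by force
        have q1: "1 / real q > 0" using q0 by simp
        have "0 \<le> z \<bullet> real_vec u + real_of_int (E u)" "z \<bullet> real_vec u + real_of_int (E u) \<le> 1"
          using z u by (auto simp: unit_slabs_def)
        note facts = this near[of z u] q1 split[of u]
        from viol have "z \<in> S"
        proof
          assume "int q * E u + pairing (floor_vec q z) u < 0"
          then have "real_of_int (int q * E u + pairing (floor_vec q z) u) < 0" by linarith
          then have "real_of_int (pairing (floor_vec q z) u) / real q + real_of_int (E u) < 0"
            using q0 by (simp add: field_simps)
          with facts have "\<bar>z \<bullet> real_vec u - (0 - real_of_int (E u))\<bar> \<le> (L u + 1) / real q" by linarith
          then show ?thesis using inS[OF u] z PW by blast
        next
          assume "int q * E u + pairing (floor_vec q z) u > int q - 1"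
          then have "real_of_int (int q * E u + pairing (floor_vec q z) u) > real q - 1" by linarith
          then have "(real q - 1) / real q < real_of_int (int q * E u + pairing (floor_vec q z) u) / real q"
            using q0 by (intro divide_strict_right_mono)
          moreover have "(real q - 1) / real q = 1 - 1 / real q"
            "real_of_int (int q * E u + pairing (floor_vec q z) u) / real q =
              real_of_int (pairing (floor_vec q z) u) / real q + real_of_int (E u)"
            using q0 by (simp_all add: field_simps)
          ultimately have "real_of_int (pairing (floor_vec q z) u) / real q + real_of_int (E u) > 1 - 1 / real q"
            by simp
          with facts have "\<bar>z \<bullet> real_vec u - (1 - real_of_int (E u))\<bar> \<le> (L u + 1) / real q" by linarith
          then show ?thesis using inS[OF u] z PW by blast
        qed
        then show ?thesis by simp
      qed (simp add: zU)
    qed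
    then have "measure lebesgue ?P \<le> measure lebesgue (U \<union> S)"
      using U P S by (intro measure_mono_fmeasurable) auto
    also have "\<dots> \<le> measure lebesgue U + measure lebesgue S" using U S by (intro measure_Un_le) auto
    finally have le2: "measure lebesgue ?P \<le> measure lebesgue U + D / real q" using mS by linarith
    from le1 le2 have "\<bar>measure lebesgue U - measure lebesgue ?P\<bar> \<le> D / real q" by linarith
    then have "\<bar>measure lebesgue U - measure lebesgue ?P\<bar> * real q ^ CARD('n) \<le> D / real q * real q ^ CARD('n)"
      by (rule mult_right_mono) simp
    also have "D / real q * real q ^ CARD('n) = D * real q ^ (CARD('n) - 1)"
      using q0 by (simp add: power_diff)
    also have "\<bar>measure lebesgue U - measure lebesgue ?P\<bar> * real q ^ CARD('n) =
        \<bar>(measure lebesgue U - measure lebesgue ?P) * real q ^ CARD('n)\<bar>"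
      using q0 by (simp add: abs_mult)
    also have "(measure lebesgue U - measure lebesgue ?P) * real q ^ CARD('n) =
        real (card ?A) - measure lebesgue ?P * real q ^ CARD('n)"
      using q0 by (simp add: mU left_diff_distrib power_divide)
    finally show ?thesis .
  qed
  then show ?thesis by blast
qed

text \<open>The polytope without its strict part \<open>G\<close> lies in finitely many hyperplanes,
  so it is negligible iff \<open>G\<close> is empty. As \<open>G\<close> is open, it is nonempty iff
  it contains a rational point m/q.\<close>

lemma measure_unit_slabs_pos_iff:
  "measure lebesgue (unit_slabs R E) > 0 \<longleftrightarrow>
     (\<exists>q\<ge>1::nat. \<exists>m. \<forall>u\<in>R. 0 < int q * E u + pairing m u \<and> int q * E u + pairing m u < int q)" (is "?L \<longleftrightarrow> ?M")
proof -
  let ?P = "unit_slabs R E"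
  define G where "G = {y. \<forall>u\<in>R. 0 < y \<bullet> real_vec u + real_of_int (E u) \<and> y \<bullet> real_vec u + real_of_int (E u) < 1}"
  have "G = (\<Inter>u\<in>R. {y. 0 < y \<bullet> real_vec u + real_of_int (E u)} \<inter> {y. y \<bullet> real_vec u + real_of_int (E u) < 1})"
    unfolding G_def by auto
  moreover have "open \<dots>"
    using finite_R by (intro open_INT ballI open_Int open_Collect_less continuous_intros)
  ultimately have "open G" by simp
  have GP: "G \<subseteq> ?P" unfolding G_def unit_slabs_def by (auto intro: less_imp_le)
  have P: "?P \<in> lmeasurable" by (rule lmeasurable_compact[OF compact_unit_slabs])
  have neg: "negligible ?P \<longleftrightarrow> G = {}"
  proof
    assume "negligible ?P"
    then have "negligible G" using GP negligible_subset by blast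
    then show "G = {}" using \<open>open G\<close> open_not_negligible by blast
  next
    assume G: "G = {}"
    have "?P \<subseteq> (\<Union>u\<in>R. {y. real_vec u \<bullet> y = - real_of_int (E u)} \<union> {y. real_vec u \<bullet> y = 1 - real_of_int (E u)})"
    proof
      fix y assume y: "y \<in> ?P"
      have "y \<notin> G" using G by simp
      then obtain u where u: "u \<in> R" "\<not> (0 < y \<bullet> real_vec u + real_of_int (E u) \<and> y \<bullet> real_vec u + real_of_int (E u) < 1)"
        by (auto simp: G_def)
      moreover have "0 \<le> y \<bullet> real_vec u + real_of_int (E u)" "y \<bullet> real_vec u + real_of_int (E u) \<le> 1"
        using y u by (auto simp: unit_slabs_def)
      ultimately have "y \<bullet> real_vec u = - real_of_int (E u) \<or> y \<bullet> real_vec u = 1 - real_of_int (E u)" by linarith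
      then show "y \<in> (\<Union>u\<in>R. {y. real_vec u \<bullet> y = - real_of_int (E u)} \<union> {y. real_vec u \<bullet> y = 1 - real_of_int (E u)})"
        using u by (auto simp: inner_commute)
    qed
    moreover have "negligible ({y. real_vec u \<bullet> y = - real_of_int (E u)} \<union> {y. real_vec u \<bullet> y = 1 - real_of_int (E u)})"
      if "u \<in> R" for u
      using that zero_notin by (intro negligible_Un negligible_hyperplane disjI1) auto
    then have "negligible (\<Union>u\<in>R. {y. real_vec u \<bullet> y = - real_of_int (E u)} \<union> {y. real_vec u \<bullet> y = 1 - real_of_int (E u)})"
      using finite_R by (intro negligible_Union) auto
    ultimately show "negligible ?P" using negligible_subset by blast
  qed
  have "?L \<longleftrightarrow> G \<noteq> {}"
    using neg negligible_iff_measure0[OF P] by (simp add: zero_less_measure_iff)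
  also have "\<dots> \<longleftrightarrow> ?M"
  proof
    assume "G \<noteq> {}"
    then obtain x where "x \<in> G" by blast
    then obtain e where e: "e > 0" "ball x e \<subseteq> G" using \<open>open G\<close> open_contains_ball by blast
    \<comment> \<open>For q > d/e the corner of the grid cube around x is closer than e, because its
      distance in the l1-norm is at most d/q.\<close>
    obtain q :: nat where q: "real CARD('n) / e < real q" using reals_Archimedean2 by blast
    have "real CARD('n) / e > 0" using e by simp
    then have q0: "real q > 0" using q by linarith
    define m where "m = floor_vec q x"
    define y where "y = (1 / real q) *\<^sub>R real_vec m"
    have "norm (x - y) \<le> (\<Sum>i\<in>UNIV. \<bar>(x - y) $ i\<bar>)" by (rule norm_le_l1_cart)
    also have "\<dots> \<le> (\<Sum>i\<in>(UNIV :: 'n set). 1 / real q)"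
    proof (rule sum_mono)
      fix i :: 'n
      have "(x - y) $ i = (real q * x $ i - real_of_int \<lfloor>real q * x $ i\<rfloor>) / real q"
        using q0 by (simp add: y_def m_def real_vec_def floor_vec_def field_simps)
      moreover have "\<bar>real q * x $ i - real_of_int \<lfloor>real q * x $ i\<rfloor>\<bar> \<le> 1" by linarith
      ultimately show "\<bar>(x - y) $ i\<bar> \<le> 1 / real q" using q0 by (simp add: divide_right_mono)
    qed
    also have "\<dots> = real CARD('n) / real q" by simp
    also have "\<dots> < e" using q q0 e by (simp add: field_simps)
    finally have "y \<in> G" using e(2) by (auto simp: dist_norm)
    have "0 < int q * E u + pairing m u \<and> int q * E u + pairing m u < int q" if "u \<in> R" for u
    proof -
      have "0 < real_of_int (pairing m u) / real q + real_of_int (E u)" "real_of_int (pairing m u) / real q + real_of_int (E u) < 1"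
        using \<open>y \<in> G\<close> that by (auto simp: G_def y_def inner_real_vec)
      then have "0 < real_of_int (int q * E u + pairing m u)" "real_of_int (int q * E u + pairing m u) < real_of_int (int q)"
        using q0 by (simp_all add: field_simps)
      then show ?thesis by (simp only: of_int_less_iff of_int_0_less_iff)
    qed
    moreover have "q \<ge> 1" using q0 by simp
    ultimately show ?M by blast
  next
    assume ?M
    then obtain q m where q: "q \<ge> (1::nat)" and m: "\<And>u. u \<in> R \<Longrightarrow> 0 < int q * E u + pairing m u \<and> int q * E u + pairing m u < int q"
      by blast
    have q0: "real q > 0" using q by simp
    have "(1 / real q) *\<^sub>R real_vec m \<in> G"
      unfolding G_def
    proof safe
      fix u assume "u \<in> R"
      from m[OF this] have "0 < real_of_int (int q * E u + pairing m u)" "real_of_int (int q * E u + pairing m u) < real_of_int (int q)"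
        by (simp_all only: of_int_less_iff of_int_0_less_iff)
      then show "0 < (1 / real q) *\<^sub>R real_vec m \<bullet> real_vec u + real_of_int (E u)"
        "(1 / real q) *\<^sub>R real_vec m \<bullet> real_vec u + real_of_int (E u) < 1"
        using q0 by (simp_all add: inner_real_vec field_simps)
    qed
    then show "G \<noteq> {}" by blast
  qed
  finally show ?thesis .
qed

end

section \<open>Divisor classes\<close>

lemma char_div_add: "char_div X (a + b) u = char_div X a u + char_div X b u"
  and char_div_diff: "char_div X (a - b) u = char_div X a u - char_div X b u"
  and char_div_minus: "char_div X (- a) u = - char_div X a u"
  and char_div_scale: "char_div X (k *s a) u = k * char_div X a u"
  and char_div_zero: "char_div X 0 u = 0"
  by (simp_all add: char_div_def pairing_add_left pairing_diff_left pairing_minus_left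
      pairing_scale_left pairing_zero_left)

lemma carrier_TDiv: "carrier (TDiv X) = {D. \<forall>u. u \<notin> rays X \<longrightarrow> D u = 0}"
  and mult_TDiv [simp]: "D \<otimes>\<^bsub>TDiv X\<^esub> E = (\<lambda>u. D u + E u)"
  and one_TDiv [simp]: "\<one>\<^bsub>TDiv X\<^esub> = (\<lambda>u. 0)"
  by (simp_all add: TDiv_def)

lemma char_div_in_TDiv: "char_div X m \<in> carrier (TDiv X)"
  by (simp add: carrier_TDiv char_div_def)

lemma comm_group_TDiv: "comm_group (TDiv X)"
proof (rule comm_groupI)
  fix D assume "D \<in> carrier (TDiv X)"
  then show "\<exists>E\<in>carrier (TDiv X). E \<otimes>\<^bsub>TDiv X\<^esub> D = \<one>\<^bsub>TDiv X\<^esub>"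
    by (intro bexI[of _ "\<lambda>u. - D u"]) (simp_all add: carrier_TDiv)
qed (auto simp: carrier_TDiv)

lemma subgroup_principal: "subgroup (principal X) (TDiv (X :: ('k::field, 'n::finite) toric_variety))"
proof -
  interpret comm_group "TDiv X" by (rule comm_group_TDiv)
  show ?thesis
    unfolding principal_eq
  proof (rule subgroupI)
    show "range (char_div X) \<subseteq> carrier (TDiv X)" using char_div_in_TDiv by blast
  next
    fix D assume "D \<in> range (char_div X)"
    then obtain m where m: "D = char_div X m" by blast
    have "inv\<^bsub>TDiv X\<^esub> D = char_div X (- m)"
    proof (rule inv_equality)
      show "char_div X (- m) \<otimes>\<^bsub>TDiv X\<^esub> D = \<one>\<^bsub>TDiv X\<^esub>" by (simp add: m char_div_minus)
    qed (simp_all add: m char_div_in_TDiv)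
    then show "inv\<^bsub>TDiv X\<^esub> D \<in> range (char_div X)" by simp
  next
    fix D E assume "D \<in> range (char_div X)" "E \<in> range (char_div X)"
    then obtain a b where "D = char_div X a" "E = char_div X b" by blast
    then have "D \<otimes>\<^bsub>TDiv X\<^esub> E = char_div X (a + b)" by (simp add: char_div_add fun_eq_iff)
    then show "D \<otimes>\<^bsub>TDiv X\<^esub> E \<in> range (char_div X)" by simp
  qed simp
qed

lemma normal_principal: "principal X \<lhd> TDiv (X :: ('k::field, 'n::finite) toric_variety)"
  by (rule comm_group.subgroup_imp_normal[OF comm_group_TDiv subgroup_principal])

lemma carrier_Cl: "carrier (Cl X) = div_class X ` carrier (TDiv X)"
  by (simp add: Cl_def carrier_FactGroup div_class_def)

lemma mem_div_class:
  "D' \<in> div_class (X :: ('k::field, 'n::finite) toric_variety) D \<longleftrightarrow> (\<exists>m. D' = (\<lambda>u. D u + char_div X m u))"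
  by (auto simp: div_class_def r_coset_def principal_eq add.commute)

lemma div_class_eq_iff:
  "div_class (X :: ('k::field, 'n::finite) toric_variety) D = div_class X E \<longleftrightarrow>
     (\<exists>m. E = (\<lambda>u. D u + char_div X m u))"
proof
  assume "div_class X D = div_class X E"
  moreover have "E \<in> div_class X E" by (auto simp: mem_div_class char_div_zero intro: exI[of _ 0])
  ultimately show "\<exists>m. E = (\<lambda>u. D u + char_div X m u)" by (simp flip: mem_div_class)
next
  assume "\<exists>m. E = (\<lambda>u. D u + char_div X m u)"
  then obtain m where m: "E = (\<lambda>u. D u + char_div X m u)" ..
  have "F \<in> div_class X D \<longleftrightarrow> F \<in> div_class X E" for F
  proof
    assume "F \<in> div_class X D"
    then obtain a where "F = (\<lambda>u. D u + char_div X a u)" by (auto simp: mem_div_class)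
    then have "F = (\<lambda>u. E u + char_div X (a - m) u)" by (simp add: m char_div_diff)
    then show "F \<in> div_class X E" unfolding mem_div_class by blast
  next
    assume "F \<in> div_class X E"
    then obtain a where "F = (\<lambda>u. E u + char_div X a u)" by (auto simp: mem_div_class)
    then have "F = (\<lambda>u. D u + char_div X (m + a) u)" by (simp add: m char_div_add add.assoc)
    then show "F \<in> div_class X D" unfolding mem_div_class by blast
  qed
  then show "div_class X D = div_class X E" by blast
qed

lemma mult_Cl:
  fixes X :: "('k::field, 'n::finite) toric_variety"
  assumes "D \<in> carrier (TDiv X)" "E \<in> carrier (TDiv X)"
  shows "div_class X D \<otimes>\<^bsub>Cl X\<^esub> div_class X E = div_class X (\<lambda>u. D u + E u)"
  using normal.rcos_sum[OF normal_principal assms] by (simp add: Cl_def div_class_def)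

lemma one_Cl: "\<one>\<^bsub>Cl X\<^esub> = div_class (X :: ('k::field, 'n::finite) toric_variety) (\<lambda>u. 0)"
proof -
  have "D \<in> principal X \<longleftrightarrow> D \<in> div_class X (\<lambda>u. 0)" for D
    by (auto simp: principal_eq mem_div_class fun_eq_iff)
  then show ?thesis by (auto simp: Cl_def)
qed

lemma pow_Cl:
  fixes X :: "('k::field, 'n::finite) toric_variety"
  assumes "D \<in> carrier (TDiv X)"
  shows "div_class X D [^]\<^bsub>Cl X\<^esub> k = div_class X (\<lambda>u. int k * D u)"
proof (induction k)
  case 0
  then show ?case by (simp add: one_Cl)
next
  case (Suc k)
  have "div_class X D [^]\<^bsub>Cl X\<^esub> Suc k = div_class X (\<lambda>u. int k * D u) \<otimes>\<^bsub>Cl X\<^esub> div_class X D"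
    by (simp add: Suc.IH)
  also have "\<dots> = div_class X (\<lambda>u. int k * D u + D u)"
    by (rule mult_Cl) (use assms in \<open>simp_all add: carrier_TDiv\<close>)
  also have "(\<lambda>u. int k * D u + D u) = (\<lambda>u. int (Suc k) * D u)" by (simp add: algebra_simps)
  finally show ?case .
qed

section \<open>Torsion, numerical classes and finiteness\<close>

lemma mem_Cl_tor:
  fixes X :: "('k::field, 'n::finite) toric_variety"
  shows "c \<in> Cl_tor X \<longleftrightarrow> (\<exists>T\<in>carrier (TDiv X). c = div_class X T \<and>
     (\<exists>k\<ge>1::nat. \<exists>m. \<forall>u. int k * T u = char_div X m u))"
proof -
  have "(\<exists>k\<ge>1::nat. div_class X T [^]\<^bsub>Cl X\<^esub> k = \<one>\<^bsub>Cl X\<^esub>) \<longleftrightarrow>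
      (\<exists>k\<ge>1::nat. \<exists>m. \<forall>u. int k * T u = char_div X m u)" if "T \<in> carrier (TDiv X)" for T
    unfolding pow_Cl[OF that] one_Cl eq_commute[of _ "div_class X (\<lambda>u. 0)"] div_class_eq_iff
    by (simp add: fun_eq_iff)
  then show ?thesis unfolding Cl_tor_def carrier_Cl by blast
qed

lemma mem_num_class:
  fixes X :: "('k::field, 'n::finite) toric_variety"
  assumes E: "E \<in> carrier (TDiv X)"
  shows "c \<in> num_class X (div_class X E) \<longleftrightarrow> (\<exists>E'\<in>carrier (TDiv X). c = div_class X E' \<and>
     (\<exists>k\<ge>1::nat. \<exists>m. \<forall>u. int k * (E' u - E u) = char_div X m u))" (is "_ \<longleftrightarrow> ?R")
proof
  assume "c \<in> num_class X (div_class X E)"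
  then obtain t where "t \<in> Cl_tor X" "c = t \<otimes>\<^bsub>Cl X\<^esub> div_class X E"
    unfolding num_class_def r_coset_def by blast
  then obtain T k m where T: "T \<in> carrier (TDiv X)" "k \<ge> (1::nat)" "\<forall>u. int k * T u = char_div X m u"
    "c = div_class X (\<lambda>u. T u + E u)"
    unfolding mem_Cl_tor using mult_Cl[OF _ E] by metis
  show ?R
    by (rule bexI[of _ "\<lambda>u. T u + E u"]) (use T E in \<open>auto simp: carrier_TDiv\<close>)
next
  assume ?R
  then obtain E' k m where E': "E' \<in> carrier (TDiv X)" "c = div_class X E'" "k \<ge> (1::nat)"
    "\<forall>u. int k * (E' u - E u) = char_div X m u" by blast
  define T where "T = (\<lambda>u. E' u - E u)"
  have T: "T \<in> carrier (TDiv X)" using E E' by (simp add: T_def carrier_TDiv)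
  have "div_class X T \<in> Cl_tor X" unfolding mem_Cl_tor using T E' by (auto simp: T_def)
  moreover have "c = div_class X T \<otimes>\<^bsub>Cl X\<^esub> div_class X E"
    unfolding mult_Cl[OF T E] by (simp add: T_def E')
  ultimately show "c \<in> num_class X (div_class X E)"
    unfolding num_class_def r_coset_def by blast
qed

text \<open>
  Reducing the character \<open>m\<close> modulo \<open>k\<close> replaces \<open>E\<close> by a linearly equivalent divisor whose
  coefficients are bounded independently of \<open>k\<close>.
\<close>

lemma finite_bounded_classes:
  fixes X :: "('k::field, 'n::finite) toric_variety"
  shows "finite {div_class X E | E. E \<in> carrier (TDiv X) \<and> (\<exists>k\<ge>1::nat. \<exists>D m.
     (\<forall>u\<in>rays X. 0 \<le> D u \<and> D u \<le> int k) \<and> (\<forall>u\<in>rays X. int k * E u = D u + pairing m u))}" (is "finite ?S")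
proof -
  define L where "L u = (\<Sum>i\<in>UNIV. \<bar>u $ i\<bar>)" for u :: "int ^ 'n"
  have L0: "L u \<ge> 0" for u by (simp add: L_def sum_nonneg)
  define N where "N = (\<Sum>u\<in>rays X. 1 + L u)"
  have N: "1 + L u \<le> N" if "u \<in> rays X" for u
    unfolding N_def using that L0 by (intro member_le_sum) (auto intro: add_nonneg_nonneg)
  define F where "F = {f. \<forall>u. (u \<in> rays X \<longrightarrow> f u \<in> {- N..N}) \<and> (u \<notin> rays X \<longrightarrow> f u = 0)}"
  have fin: "finite F" unfolding F_def by (rule finite_set_of_finite_funs) auto
  have sub: "?S \<subseteq> div_class X ` F"
  proof safe
    fix E D m and k :: nat
    assume E: "E \<in> carrier (TDiv X)" and k: "k \<ge> 1" and D: "\<forall>u\<in>rays X. 0 \<le> D u \<and> D u \<le> int k"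
      and kE: "\<forall>u\<in>rays X. int k * E u = D u + pairing m u"
    define d where "d = (\<chi> i. m $ i div int k)"
    define r where "r = (\<chi> i. m $ i mod int k)"
    have m: "m = int k *s d + r" by (simp add: vec_eq_iff d_def r_def)
    define E' where "E' = (\<lambda>u. E u + char_div X (- d) u)"
    \<comment> \<open>From k E'(u) = D(u) + <r, u> with 0 <= D(u) <= k and 0 <= r_i < k, division by
      k leaves the bound 1 + L u, free of k.\<close>
    have "E' u \<in> {- N..N}" if u: "u \<in> rays X" for u
    proof -
      have eq: "int k * E' u = D u + pairing r u"
        using kE u by (simp add: E'_def char_div_def pairing_minus_left m pairing_add_left
            pairing_scale_left right_diff_distrib)
      have "\<bar>pairing r u\<bar> \<le> (\<Sum>i\<in>UNIV. \<bar>r $ i * u $ i\<bar>)" unfolding pairing_def by (rule sum_abs)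
      also have "\<dots> \<le> (\<Sum>i\<in>UNIV. int k * \<bar>u $ i\<bar>)"
      proof (rule sum_mono)
        fix i :: 'n
        have "0 \<le> r $ i" "r $ i < int k" using k by (simp_all add: r_def)
        then show "\<bar>r $ i * u $ i\<bar> \<le> int k * \<bar>u $ i\<bar>" unfolding abs_mult by (intro mult_right_mono) auto
      qed
      also have "\<dots> = int k * L u" by (simp add: L_def sum_distrib_left)
      finally have "\<bar>int k * E' u\<bar> \<le> int k + int k * L u" using eq D u by fastforce
      then have "int k * \<bar>E' u\<bar> \<le> int k * (1 + L u)" by (simp add: abs_mult distrib_left)
      then have "\<bar>E' u\<bar> \<le> 1 + L u" using k by (simp add: mult_le_cancel_left)
      then show ?thesis using N[OF u] by auto
    qed
    then have "E' \<in> F" using E by (simp add: F_def carrier_TDiv E'_def char_div_def)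
    moreover have "div_class X E = div_class X E'" unfolding div_class_eq_iff E'_def by blast
    ultimately show "div_class X E \<in> div_class X ` F" by blast
  qed
  show ?thesis by (rule finite_subset[OF sub finite_imageI[OF fin]])
qed

text \<open>A torsion relation k T = div \<chi>^m is the case D = 0 of the bounded classes.\<close>

lemma finite_Cl_tor: "finite (Cl_tor (X :: ('k::field, 'n::finite) toric_variety))"
proof (rule finite_subset[OF _ finite_bounded_classes], rule subsetI)
  fix c assume "c \<in> Cl_tor X"
  then obtain T k m where T: "T \<in> carrier (TDiv X)" "c = div_class X T" "k \<ge> (1::nat)"
    "\<forall>u. int k * T u = char_div X m u" unfolding mem_Cl_tor by blast
  then have "\<forall>u\<in>rays X. int k * T u = 0 + pairing m u" by (simp add: char_div_def)
  with T show "c \<in> {div_class X E | E. E \<in> carrier (TDiv X) \<and> (\<exists>k\<ge>1::nat. \<exists>D m.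
     (\<forall>u\<in>rays X. 0 \<le> D u \<and> D u \<le> int k) \<and> (\<forall>u\<in>rays X. int k * E u = D u + pairing m u))}"
    by (intro CollectI exI[of _ T] conjI exI[of _ k] exI[of _ "\<lambda>u. 0"] exI[of _ m]) auto
qed

lemma finite_num_class: "finite (num_class (X :: ('k::field, 'n::finite) toric_variety) c)"
  by (simp add: num_class_def r_coset_def finite_Cl_tor)

text \<open>Here the multiplier k is q itself and D is any divisor counted by the
  multiplicity.\<close>

lemma finite_effective_classes:
  fixes X :: "('k::field, 'n::finite) toric_variety"
  shows "finite {c \<in> carrier (Cl X). \<exists>q\<ge>1. mult_of X c q \<noteq> 0}"
proof (rule finite_subset[OF _ finite_bounded_classes], rule subsetI)
  fix c assume "c \<in> {c \<in> carrier (Cl X). \<exists>q\<ge>1. mult_of X c q \<noteq> 0}"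
  then obtain E q where E: "E \<in> carrier (TDiv X)" "c = div_class X E" "q \<ge> 1" "mult_of X c q \<noteq> 0"
    unfolding carrier_Cl by blast
  from E(4) have "{D \<in> carrier (TDiv X). (\<forall>u\<in>rays X. D u \<in> {0..int q - 1}) \<and>
      div_class X D = c [^]\<^bsub>Cl X\<^esub> q} \<noteq> {}" unfolding mult_of_def by (metis card.empty)
  then obtain D where D: "\<forall>u\<in>rays X. D u \<in> {0..int q - 1}" "div_class X D = c [^]\<^bsub>Cl X\<^esub> q" by blast
  then obtain m where "(\<lambda>u. int q * E u) = (\<lambda>u. D u + char_div X m u)"
    unfolding E(2) pow_Cl[OF E(1)] div_class_eq_iff by blast
  then have "\<forall>u\<in>rays X. int q * E u = D u + pairing m u" by (metis char_div_def)
  moreover have "\<forall>u\<in>rays X. 0 \<le> D u \<and> D u \<le> int q" using D(1) by fastforce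
  ultimately show "c \<in> {div_class X E | E. E \<in> carrier (TDiv X) \<and> (\<exists>k\<ge>1::nat. \<exists>D m.
     (\<forall>u\<in>rays X. 0 \<le> D u \<and> D u \<le> int k) \<and> (\<forall>u\<in>rays X. int k * E u = D u + pairing m u))}"
    using E(1-3) by blast
qed

text \<open>Finiteness gives the sum defining the ample F-signature its intended meaning and lets
  positivity be tested term by term.\<close>

lemma finite_FS:
  fixes X :: "('k::field, 'n::finite) toric_variety"
  assumes "CHAR('k) > 0"
  shows "finite (FS X)"
proof (rule finite_subset[OF _ finite_imageI[OF finite_effective_classes]], rule subsetI)
  fix \<epsilon> assume "\<epsilon> \<in> FS X"
  then obtain c e where "\<epsilon> = num_class X c" "c \<in> carrier (Cl X)" "mult_of X c (CHAR('k) ^ e) \<noteq> 0"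
    unfolding FS_def by blast
  moreover have "CHAR('k) ^ e \<ge> 1" using assms by simp
  ultimately show "\<epsilon> \<in> num_class X ` {c \<in> carrier (Cl X). \<exists>q\<ge>1. mult_of X c q \<noteq> 0}" by blast
qed

section \<open>Asymptotic multiplicity of a class\<close>

lemma char_div_inject:
  assumes "complete_variety X" "char_div X a = char_div X b"
  shows "a = b"
proof -
  have "real_vec (a - b) \<bullet> real_vec u = 0" if "u \<in> rays X" for u
    using fun_cong[OF assms(2), of u] that by (simp add: inner_real_vec pairing_diff_left char_div_def)
  then have "real_vec (a - b) = 0" by (intro complete_nonneg_imp_0[OF assms(1)]) simp
  then show ?thesis by simp
qed

text \<open>The divisors linearly equivalent to q E are exactly q E + div \<chi>^m, and on a
  complete variety m is determined by the divisor; the coefficient bounds become the bounds on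
  lattice points.\<close>

lemma mult_of_eq_card:
  fixes X :: "('k::field, 'n::finite) toric_variety"
  assumes X: "complete_variety X" and E: "E \<in> carrier (TDiv X)"
  shows "mult_of X (div_class X E) q = card (scaled_lattice_points (rays X) E q)"
proof -
  define f where "f = (\<lambda>m u. int q * E u + char_div X m u)"
  have "inj_on f (scaled_lattice_points (rays X) E q)"
  proof (rule inj_onI)
    fix a b assume "f a = f b"
    then have "char_div X a = char_div X b" by (simp add: f_def fun_eq_iff)
    then show "a = b" by (rule char_div_inject[OF X])
  qed
  then have "card (scaled_lattice_points (rays X) E q) = card (f ` scaled_lattice_points (rays X) E q)"
    by (rule card_image[symmetric])
  also have "f ` scaled_lattice_points (rays X) E q =
      {D \<in> carrier (TDiv X). (\<forall>u\<in>rays X. D u \<in> {0..int q - 1}) \<and> div_class X D = div_class X E [^]\<^bsub>Cl X\<^esub> q}" (is "?A = ?B")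
  proof
    show "?A \<subseteq> ?B"
    proof (intro image_subsetI CollectI conjI ballI)
      fix m assume m: "m \<in> scaled_lattice_points (rays X) E q"
      show "f m \<in> carrier (TDiv X)" using E by (simp add: f_def carrier_TDiv char_div_def)
      show "f m u \<in> {0..int q - 1}" if "u \<in> rays X" for u
        using m that by (simp add: f_def char_div_def scaled_lattice_points_def)
      have "div_class X (\<lambda>u. int q * E u) = div_class X (f m)"
        unfolding div_class_eq_iff f_def by blast
      then show "div_class X (f m) = div_class X E [^]\<^bsub>Cl X\<^esub> q"
        by (simp add: pow_Cl[OF E])
    qed
    show "?B \<subseteq> ?A"
    proof
      fix D assume D: "D \<in> ?B"
      then have "div_class X (\<lambda>u. int q * E u) = div_class X D" by (simp add: pow_Cl[OF E])
      then obtain m where m: "D = f m" unfolding div_class_eq_iff f_def by blast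
      have "m \<in> scaled_lattice_points (rays X) E q"
        unfolding scaled_lattice_points_def
      proof (intro CollectI ballI)
        fix u assume "u \<in> rays X"
        then have "f m u \<in> {0..int q - 1}" using D m by simp
        then show "0 \<le> int q * E u + pairing m u \<and> int q * E u + pairing m u \<le> int q - 1"
          using \<open>u \<in> rays X\<close> by (simp add: f_def char_div_def)
      qed
      then show "D \<in> ?A" using m by blast
    qed
  qed
  finally show ?thesis unfolding mult_of_def by simp
qed

lemma bounded_slab_family_rays: "complete_variety X \<Longrightarrow> bounded_slab_family (rays X)"
  by (simp add: bounded_slab_family_def zero_notin_rays complete_bounded_slabs)

text \<open>Changing the representative by div \<chi>^a translates the polytope by a lattice vector,
  so the chosen representative does not affect the volume.\<close>

definition class_volume ::
    "('k::field, 'n::finite) toric_variety \<Rightarrow> (int ^ 'n \<Rightarrow> int) set \<Rightarrow> real" where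
  "class_volume X c =
     measure lebesgue (unit_slabs (rays X) (SOME E. E \<in> carrier (TDiv X) \<and> c = div_class X E))"

lemma mult_of_asymp:
  fixes X :: "('k::field, 'n::finite) toric_variety"
  assumes X: "complete_variety X" and c: "c \<in> carrier (Cl X)"
  shows "\<exists>C. \<forall>q\<ge>1. \<bar>real (mult_of X c q) - class_volume X c * real q ^ CARD('n)\<bar> \<le> C * real q ^ (CARD('n) - 1)"
proof -
  define E where "E = (SOME E. E \<in> carrier (TDiv X) \<and> c = div_class X E)"
  have "\<exists>E. E \<in> carrier (TDiv X) \<and> c = div_class X E" using c by (auto simp: carrier_Cl)
  then have E: "E \<in> carrier (TDiv X)" "c = div_class X E" unfolding E_def by (metis (mono_tags, lifting) someI_ex)+
  have vol: "class_volume X c = measure lebesgue (unit_slabs (rays X) E)" by (simp add: class_volume_def E_def)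
  have mult: "mult_of X c q = card (scaled_lattice_points (rays X) E q)" for q
    using mult_of_eq_card[OF X E(1)] E(2) by simp
  show ?thesis
    unfolding vol mult
    by (rule bounded_slab_family.card_scaled_lattice_points[OF bounded_slab_family_rays[OF X]])
qed

text \<open>If the chosen representative is E + div \<chi>^a, the condition for it turns into the
  one for \<open>E\<close> when m is replaced by q a + m.\<close>

lemma class_volume_pos_iff:
  fixes X :: "('k::field, 'n::finite) toric_variety"
  assumes X: "complete_variety X" and E: "E \<in> carrier (TDiv X)"
  shows "class_volume X (div_class X E) > 0 \<longleftrightarrow>
    (\<exists>q\<ge>1::nat. \<exists>m. \<forall>u\<in>rays X. 0 < int q * E u + pairing m u \<and> int q * E u + pairing m u < int q)"
proof -
  define E' where "E' = (SOME E'. E' \<in> carrier (TDiv X) \<and> div_class X E = div_class X E')"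
  have "E' \<in> carrier (TDiv X) \<and> div_class X E = div_class X E'"
    unfolding E'_def by (rule someI[of _ E]) (simp add: E)
  then obtain a where a: "E' = (\<lambda>u. E u + char_div X a u)" unfolding div_class_eq_iff by blast
  have vol: "class_volume X (div_class X E) = measure lebesgue (unit_slabs (rays X) E')"
    by (simp add: class_volume_def E'_def)
  let ?Q = "\<lambda>E (q::nat) m. \<forall>u\<in>rays X. 0 < int q * E u + pairing m u \<and> int q * E u + pairing m u < int q"
  have shift: "int q * E' u + pairing m u = int q * E u + pairing (int q *s a + m) u" if "u \<in> rays X" for q m u
    using that by (simp add: a char_div_def pairing_add_left pairing_scale_left distrib_left)
  have "(\<exists>m. ?Q E' q m) \<longleftrightarrow> (\<exists>m. ?Q E q m)" for q
  proof
    assume "\<exists>m. ?Q E' q m"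
    then obtain m where "?Q E' q m" ..
    then have "?Q E q (int q *s a + m)" using shift by simp
    then show "\<exists>m. ?Q E q m" ..
  next
    assume "\<exists>m. ?Q E q m"
    then obtain m where "?Q E q m" ..
    then have "?Q E' q (m - int q *s a)" using shift[of _ q "m - int q *s a"] by simp
    then show "\<exists>m. ?Q E' q m" ..
  qed
  then show ?thesis
    unfolding vol bounded_slab_family.measure_unit_slabs_pos_iff[OF bounded_slab_family_rays[OF X]] by simp
qed

lemma CHAR_ge_2:
  assumes "CHAR('k::field) > 0"
  shows "CHAR('k) \<ge> 2"
proof -
  have "CHAR('k) \<noteq> 1" using CHAR_not_1'[where 'a = 'k] by simp
  then show ?thesis using assms by linarith
qed

text \<open>Subtracting the two estimates leaves |b - a| q^n <= C q^(n-1) for all large q = p^e.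
  Cancelling q^(n-1), with n >= 1 so that the exponent really drops, bounds q, although powers of p
  >= 2 are unbounded.\<close>

lemma leading_coefficient_unique:
  fixes f :: "nat \<Rightarrow> real"
  assumes p: "p \<ge> (2::nat)" and n: "n \<ge> (1::nat)"
    and a: "(\<lambda>e. f e - a * real (p ^ e) ^ n) \<in> O(\<lambda>e. real (p ^ e) ^ (n - 1))"
    and b: "(\<lambda>e. f e - b * real (p ^ e) ^ n) \<in> O(\<lambda>e. real (p ^ e) ^ (n - 1))"
  shows "a = b"
proof (rule ccontr)
  assume "a \<noteq> b"
  have "(\<lambda>e. (f e - a * real (p ^ e) ^ n) - (f e - b * real (p ^ e) ^ n)) \<in> O(\<lambda>e. real (p ^ e) ^ (n - 1))"
    by (rule sum_in_bigo(2)[OF a b])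
  then have "(\<lambda>e. (b - a) * real (p ^ e) ^ n) \<in> O(\<lambda>e. real (p ^ e) ^ (n - 1))"
    by (simp add: algebra_simps)
  then obtain C where C: "eventually (\<lambda>e. norm ((b - a) * real (p ^ e) ^ n) \<le> C * norm (real (p ^ e) ^ (n - 1))) sequentially"
    by (elim landau_o.bigE)
  obtain e0 where e0: "C / \<bar>b - a\<bar> < real p ^ e0" using real_arch_pow[of "real p"] p by auto
  have "eventually (\<lambda>e. real p ^ e > C / \<bar>b - a\<bar>) sequentially"
  proof (rule eventually_sequentiallyI)
    fix e assume "e0 \<le> e"
    then have "real p ^ e0 \<le> real p ^ e" using p by (intro power_increasing) auto
    with e0 show "real p ^ e > C / \<bar>b - a\<bar>" by linarith
  qed
  with C have "eventually (\<lambda>e. False) sequentially"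
  proof eventually_elim
    case (elim e)
    define q where "q = real p ^ e"
    have q0: "q > 0" using p by (simp add: q_def)
    have "q ^ n = q * q ^ (n - 1)" using n by (simp flip: power_Suc)
    then have "(\<bar>b - a\<bar> * q) * q ^ (n - 1) \<le> C * q ^ (n - 1)"
      using elim(1) q0 by (simp add: abs_mult mult.assoc flip: q_def)
    then have "\<bar>b - a\<bar> * q \<le> C" using q0 by (simp add: mult_le_cancel_right)
    then have "q \<le> C / \<bar>b - a\<bar>" using \<open>a \<noteq> b\<close> by (simp add: field_simps)
    then show ?case using elim(2) by (simp add: q_def)
  qed
  then show False by simp
qed

lemma num_class_subset:
  fixes X :: "('k::field, 'n::finite) toric_variety"
  assumes "c \<in> carrier (Cl X)"
  shows "num_class X c \<subseteq> carrier (Cl X)"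
proof -
  obtain E where "E \<in> carrier (TDiv X)" "c = div_class X E" using assms by (auto simp: carrier_Cl)
  then show ?thesis using mem_num_class[of E] unfolding carrier_Cl by blast
qed

text \<open>The errors O(q^(d-1)) of the individual classes add up over the numerical class, so the
  sum of volumes satisfies the defining description; uniqueness of the leading coefficient
  identifies it.\<close>

lemma alpha_eq:
  fixes X :: "('k::field, 'n::finite) toric_variety"
  assumes p: "CHAR('k) > 0" and X: "complete_variety X" and c0: "c0 \<in> carrier (Cl X)"
  shows "alpha X (num_class X c0) = (\<Sum>c\<in>num_class X c0. class_volume X c)"
proof -
  let ?\<epsilon> = "num_class X c0" and ?p = "CHAR('k)"
  have "\<forall>c\<in>?\<epsilon>. \<exists>C. \<forall>q\<ge>1. \<bar>real (mult_of X c q) - class_volume X c * real q ^ CARD('n)\<bar> \<le> C * real q ^ (CARD('n) - 1)"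
    using mult_of_asymp[OF X] num_class_subset[OF c0] by blast
  from bchoice[OF this] obtain C where C: "\<And>c q. c \<in> ?\<epsilon> \<Longrightarrow> q \<ge> 1 \<Longrightarrow>
      \<bar>real (mult_of X c q) - class_volume X c * real q ^ CARD('n)\<bar> \<le> C c * real q ^ (CARD('n) - 1)" by blast
  define a where "a = (\<Sum>c\<in>?\<epsilon>. class_volume X c)"
  have bound: "\<bar>real (mult_num X ?\<epsilon> q) - a * real q ^ CARD('n)\<bar> \<le> (\<Sum>c\<in>?\<epsilon>. C c) * real q ^ (CARD('n) - 1)" if "q \<ge> 1" for q
  proof -
    have "real (mult_num X ?\<epsilon> q) - a * real q ^ CARD('n) =
        (\<Sum>c\<in>?\<epsilon>. real (mult_of X c q) - class_volume X c * real q ^ CARD('n))"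
      by (simp add: mult_num_def a_def sum_subtractf sum_distrib_right)
    also have "\<bar>\<dots>\<bar> \<le> (\<Sum>c\<in>?\<epsilon>. C c * real q ^ (CARD('n) - 1))"
      by (rule order_trans[OF sum_abs sum_mono]) (rule C[OF _ that])
    finally show ?thesis by (simp add: sum_distrib_right)
  qed
  have "norm (real (mult_num X ?\<epsilon> (?p ^ e)) - a * real (?p ^ e) ^ CARD('n))
      \<le> (\<Sum>c\<in>?\<epsilon>. C c) * norm (real (?p ^ e) ^ (CARD('n) - 1))" for e
  proof -
    have "?p ^ e \<ge> 1" using p by simp
    moreover have "norm (real (?p ^ e) ^ (CARD('n) - 1)) = real (?p ^ e) ^ (CARD('n) - 1)" by simp
    ultimately show ?thesis using bound[of "?p ^ e"] by (simp only: real_norm_def)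
  qed
  then have big: "(\<lambda>e. real (mult_num X ?\<epsilon> (?p ^ e)) - a * real (?p ^ e) ^ CARD('n))
      \<in> O(\<lambda>e. real (?p ^ e) ^ (CARD('n) - 1))"
    by (intro bigoI[OF always_eventually[OF allI]])
  show ?thesis
    unfolding alpha_def a_def[symmetric]
  proof (rule the_equality)
    fix b
    assume b: "(\<lambda>e. real (mult_num X ?\<epsilon> (?p ^ e)) - b * real (?p ^ e) ^ CARD('n))
      \<in> O(\<lambda>e. real (?p ^ e) ^ (CARD('n) - 1))"
    have "CARD('n) \<ge> 1" by (simp add: Suc_le_eq)
    then show "b = a" by (rule leading_coefficient_unique[OF CHAR_ge_2[OF p] _ b big])
  qed (rule big)
qed

section \<open>The ample F-signature\<close>

lemma class_volume_nonneg: "class_volume X c \<ge> 0"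
  by (simp add: class_volume_def)

lemma sum_pos_iff_ex:
  fixes f :: "'a \<Rightarrow> real"
  assumes "finite I" "\<And>i. i \<in> I \<Longrightarrow> f i \<ge> 0"
  shows "sum f I > 0 \<longleftrightarrow> (\<exists>i\<in>I. f i > 0)"
proof -
  have "sum f I > 0 \<longleftrightarrow> sum f I \<noteq> 0" using sum_nonneg[of I f] assms(2) by (simp add: order_less_le)
  also have "\<dots> \<longleftrightarrow> (\<exists>i\<in>I. f i \<noteq> 0)" using sum_nonneg_eq_0_iff[OF assms] by simp
  also have "\<dots> \<longleftrightarrow> (\<exists>i\<in>I. f i > 0)" using assms(2) by (intro bex_cong) (auto simp: order_less_le)
  finally show ?thesis .
qed

text \<open>Both levels of summation, over numerical classes and over their torsion translates, are
  finite with nonnegative terms, so no cancellation can hide a positive volume.\<close>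

lemma ample_F_signature_pos_iff:
  fixes X :: "('k::field, 'n::finite) toric_variety"
  assumes p: "CHAR('k) > 0" and X: "complete_variety X"
  shows "ample_F_signature X > 0 \<longleftrightarrow> (\<exists>\<epsilon>\<in>AFS X. \<exists>c\<in>\<epsilon>. class_volume X c > 0)"
proof -
  have AFS: "\<exists>c. \<epsilon> = num_class X c \<and> c \<in> carrier (Cl X)" if "\<epsilon> \<in> AFS X" for \<epsilon>
    using that by (auto simp: AFS_def FS_def)
  have alpha: "alpha X \<epsilon> = (\<Sum>c\<in>\<epsilon>. class_volume X c)" "finite \<epsilon>" if "\<epsilon> \<in> AFS X" for \<epsilon>
    using AFS[OF that] alpha_eq[OF p X] finite_num_class by blast+
  have nonneg: "alpha X \<epsilon> \<ge> 0" if "\<epsilon> \<in> AFS X" for \<epsilon>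
    unfolding alpha(1)[OF that] by (rule sum_nonneg) (rule class_volume_nonneg)
  have fin: "finite (AFS X)" by (rule finite_subset[OF _ finite_FS[OF p]]) (auto simp: AFS_def)
  have "ample_F_signature X > 0 \<longleftrightarrow> (\<exists>\<epsilon>\<in>AFS X. alpha X \<epsilon> > 0)"
    unfolding ample_F_signature_def by (rule sum_pos_iff_ex[OF fin nonneg])
  also have "\<dots> \<longleftrightarrow> (\<exists>\<epsilon>\<in>AFS X. \<exists>c\<in>\<epsilon>. class_volume X c > 0)"
  proof (rule bex_cong[OF refl])
    fix \<epsilon> assume \<epsilon>: "\<epsilon> \<in> AFS X"
    show "alpha X \<epsilon> > 0 \<longleftrightarrow> (\<exists>c\<in>\<epsilon>. class_volume X c > 0)"
      unfolding alpha(1)[OF \<epsilon>] by (rule sum_pos_iff_ex[OF alpha(2)[OF \<epsilon>] class_volume_nonneg])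
  qed
  finally show ?thesis .
qed

text \<open>Once q exceeds C divided by the volume, the main term dominates the error and the count
  cannot vanish.\<close>

lemma mult_of_pos:
  fixes X :: "('k::field, 'n::finite) toric_variety"
  assumes p: "CHAR('k) > 0" and X: "complete_variety X" and c: "c \<in> carrier (Cl X)"
    and vol: "class_volume X c > 0"
  shows "\<exists>e>0. mult_of X c (CHAR('k) ^ e) \<noteq> 0"
proof -
  let ?p = "CHAR('k)"
  obtain C where C: "\<And>q. q \<ge> 1 \<Longrightarrow> \<bar>real (mult_of X c q) - class_volume X c * real q ^ CARD('n)\<bar> \<le> C * real q ^ (CARD('n) - 1)"
    using mult_of_asymp[OF X c] by blast
  have p2: "real ?p > 1" using CHAR_ge_2[OF p] by simp
  obtain e where e: "C / class_volume X c < real ?p ^ e" using real_arch_pow[OF p2] by blast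
  \<comment> \<open>The successor makes the exponent positive, as the Frobenius support demands; the
    power only grows.\<close>
  define q where "q = ?p ^ Suc e"
  have q1: "q \<ge> 1" using p by (simp add: q_def Suc_le_eq)
  have "real ?p ^ e \<le> real q" using p2 by (simp add: q_def)
  then have "class_volume X c * real ?p ^ e \<le> class_volume X c * real q"
    using vol by (intro mult_left_mono) auto
  moreover have "C < class_volume X c * real ?p ^ e" using e vol by (simp add: field_simps)
  ultimately have "C < class_volume X c * real q" by linarith
  then have "C * real q ^ (CARD('n) - 1) < class_volume X c * real q * real q ^ (CARD('n) - 1)"
    using q1 by (intro mult_strict_right_mono) auto
  also have "\<dots> = class_volume X c * real q ^ CARD('n)"
    by (simp add: mult.assoc flip: power_Suc)
  finally have "mult_of X c q \<noteq> 0" using C[OF q1] by (auto simp: abs_if split: if_splits)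
  then show ?thesis unfolding q_def by blast
qed

section \<open>Ampleness on numerical classes and log Fano boundaries\<close>

lemma ample_num_equiv:
  fixes X :: "('k::field, 'n::finite) toric_variety"
  assumes "ample X (\<lambda>u. of_int (E u))" "k \<ge> (1::nat)" "\<And>u. int k * (E' u - E u) = char_div X m u"
  shows "ample X (\<lambda>u. of_int (E' u))"
proof (rule ample_Q_lin_equiv[OF assms(1,2)])
  fix u
  have "of_nat k * (of_int (E' u) - of_int (E u)) = (of_int (int k * (E' u - E u)) :: rat)" by simp
  then show "of_nat k * (of_int (E' u) - of_int (E u)) = (of_int (char_div X m u) :: rat)"
    using assms(3) by simp
qed

text \<open>The definition asks for one ample divisor somewhere in the numerical class. Any two
  divisors of the class differ by a divisor with a principal multiple, so ampleness spreads to all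
  representatives.\<close>

lemma AFS_iff:
  fixes X :: "('k::field, 'n::finite) toric_variety"
  shows "\<epsilon> \<in> AFS X \<longleftrightarrow> \<epsilon> \<in> FS X \<and> (\<forall>E\<in>carrier (TDiv X). div_class X E \<in> \<epsilon> \<longrightarrow> ample X (\<lambda>u. of_int (E u)))"
proof
  assume "\<epsilon> \<in> AFS X"
  then obtain c E0 where \<epsilon>: "\<epsilon> \<in> FS X" "c \<in> \<epsilon>" "E0 \<in> c" "ample X (\<lambda>u. of_int (E0 u))"
    unfolding AFS_def by blast
  obtain D where D: "\<epsilon> = num_class X (div_class X D)" "D \<in> carrier (TDiv X)"
    using \<epsilon>(1) by (auto simp: FS_def carrier_Cl)
  obtain D' k' m' where D': "c = div_class X D'" "k' \<ge> (1::nat)" "\<forall>u. int k' * (D' u - D u) = char_div X m' u"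
    using \<epsilon>(2) unfolding D(1) mem_num_class[OF D(2)] by blast
  obtain a where a: "E0 = (\<lambda>u. D' u + char_div X a u)" using \<epsilon>(3) unfolding D'(1) mem_div_class ..
  have "ample X (\<lambda>u. of_int (E u))" if E: "E \<in> carrier (TDiv X)" "div_class X E \<in> \<epsilon>" for E
  proof -
    obtain E' k m where E': "div_class X E = div_class X E'" "k \<ge> (1::nat)" "\<forall>u. int k * (E' u - D u) = char_div X m u"
      using E(2) unfolding D(1) mem_num_class[OF D(2)] by blast
    obtain b where b: "E' = (\<lambda>u. E u + char_div X b u)" using E'(1) unfolding div_class_eq_iff ..
    show ?thesis
    proof (rule ample_num_equiv[OF \<epsilon>(4)])
      \<comment> \<open>The product clears both torsion relations, those of the given divisor and of
        the known ample one, at once.\<close>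
      show "k * k' \<ge> 1" using E'(2) D'(2) by simp
      fix u
      have "int (k * k') * (E u - E0 u) = int k' * (int k * (E' u - D u)) - int k * (int k' * (D' u - D u))
          - int (k * k') * (char_div X b u + char_div X a u)"
        by (simp add: a b algebra_simps)
      also have "\<dots> = int k' * char_div X m u - int k * char_div X m' u
          - int (k * k') * (char_div X b u + char_div X a u)"
        using E'(3) D'(3) by simp
      also have "\<dots> = char_div X (int k' *s m - int k *s m' - int (k * k') *s (b + a)) u"
        by (simp only: char_div_diff char_div_scale char_div_add)
      finally show "int (k * k') * (E u - E0 u) = char_div X (int k' *s m - int k *s m' - int (k * k') *s (b + a)) u" .
    qed
  qed
  then show "\<epsilon> \<in> FS X \<and> (\<forall>E\<in>carrier (TDiv X). div_class X E \<in> \<epsilon> \<longrightarrow> ample X (\<lambda>u. of_int (E u)))"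
    using \<epsilon>(1) by blast
next
  assume R: "\<epsilon> \<in> FS X \<and> (\<forall>E\<in>carrier (TDiv X). div_class X E \<in> \<epsilon> \<longrightarrow> ample X (\<lambda>u. of_int (E u)))"
  then obtain D where D: "\<epsilon> = num_class X (div_class X D)" "D \<in> carrier (TDiv X)"
    by (auto simp: FS_def carrier_Cl)
  have "div_class X D \<in> \<epsilon>" unfolding D(1) mem_num_class[OF D(2)]
    using D(2) by (intro bexI[of _ D] conjI refl exI[of _ 1] exI[of _ 0]) (simp_all add: char_div_zero)
  moreover have "D \<in> div_class X D" unfolding mem_div_class by (rule exI[of _ 0]) (simp add: char_div_zero)
  ultimately show "\<epsilon> \<in> AFS X" using R D(2) unfolding AFS_def by blast
qed

text \<open>The coefficients of -(K + \<Delta>) are 1 - \<delta>; positivity of \<delta> bounds them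
  strictly by 1 and KLT makes them positive. Class index one supplies an integral divisor, and the
  multiplier of the \<rat>-linear equivalence serves as q.\<close>

lemma exists_log_Fano_iff:
  fixes X :: "('k::field, 'n::finite) toric_variety"
  shows "(\<exists>\<Delta>. toric_boundary X \<Delta> \<and> log_Fano X \<Delta> \<and> class_index X \<Delta> = 1) \<longleftrightarrow>
    (\<exists>E\<in>carrier (TDiv X). ample X (\<lambda>u. of_int (E u)) \<and>
       (\<exists>q\<ge>1::nat. \<exists>m. \<forall>u\<in>rays X. 0 < int q * E u + pairing m u \<and> int q * E u + pairing m u < int q))" (is "?L \<longleftrightarrow> ?R")
proof
  assume ?L
  then obtain \<Delta> where \<Delta>: "toric_boundary X \<Delta>" "log_Fano X \<Delta>" "class_index X \<Delta> = 1" by blast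
  define A where "A = log_canonical_divisor X \<Delta>"
  have A_out: "A u = 0" if "u \<notin> rays X" for u
    using that \<Delta>(1) by (simp add: A_def log_canonical_divisor_def canonical_divisor_def toric_boundary_def)
  have A_in: "A u = \<Delta> u - 1" "0 < - A u" "- A u < 1" if "u \<in> rays X" for u
    using that \<Delta>(1,2)
    by (auto simp: A_def log_canonical_divisor_def canonical_divisor_def toric_boundary_def log_Fano_def KLT_def)
  define Q where "Q n \<longleftrightarrow> n \<ge> 1 \<and> (\<exists>E\<in>carrier (TDiv X).
     Q_lin_equiv X (\<lambda>u. of_nat n * A u) (\<lambda>u. of_int (E u)))" for n :: nat
  have index: "class_index X \<Delta> = (LEAST n. Q n)" by (simp add: class_index_def Q_def A_def)
  text \<open>Without this, the \<open>LEAST\<close> in the class index would carry no information.\<close>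
  have "\<exists>n. Q n"
  proof -
    \<comment> \<open>A common denominator of all coefficients of K + \<Delta>; multiplying by it
      already gives an integral divisor.\<close>
    define n where "n = (\<Prod>u\<in>rays X. snd (quotient_of (A u)))"
    have n: "n > 0" unfolding n_def by (intro prod_pos) (simp add: quotient_of_denom_pos')
    have "\<forall>u\<in>rays X. \<exists>z. of_int n * A u = (of_int z :: rat)"
    proof
      fix u assume u: "u \<in> rays X"
      obtain a b where ab: "quotient_of (A u) = (a, b)" by fastforce
      have "b dvd n" unfolding n_def using dvd_prodI[OF finite_rays u, of "\<lambda>u. snd (quotient_of (A u))"] ab by simp
      then obtain t where t: "n = b * t" by blast
      have "b > 0" using quotient_of_denom_pos[OF ab] .
      then have "of_int n * A u = of_int (t * a)" using quotient_of_div[OF ab] by (simp add: t)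
      then show "\<exists>z. of_int n * A u = (of_int z :: rat)" by blast
    qed
    from bchoice[OF this] obtain z where z: "\<forall>u\<in>rays X. of_int n * A u = (of_int (z u) :: rat)" by blast
    define E where "E = (\<lambda>u. if u \<in> rays X then z u else 0)"
    have "E \<in> carrier (TDiv X)" by (simp add: carrier_TDiv E_def)
    moreover have "of_nat (nat n) * A u = (of_int (E u) :: rat)" for u
      using z A_out n by (simp add: E_def of_nat_nat)
    then have "Q_lin_equiv X (\<lambda>u. of_nat (nat n) * A u) (\<lambda>u. of_int (E u))"
      unfolding Q_lin_equiv_def principal_eq
      by (intro exI[of _ 1] conjI bexI[of _ "char_div X 0"]) (simp_all add: char_div_zero)
    moreover have "nat n \<ge> 1" using n by simp
    ultimately show ?thesis unfolding Q_def by blast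
  qed
  then have "Q (class_index X \<Delta>)" unfolding index by (rule LeastI_ex)
  then obtain E k m where E: "E \<in> carrier (TDiv X)" "k \<ge> (1::nat)" "\<And>u. of_nat k * (A u - of_int (E u)) = (of_int (char_div X m u) :: rat)"
    unfolding \<Delta>(3) Q_def Q_lin_equiv_def principal_eq by auto
  \<comment> \<open>The class index provides \<open>E\<close> equivalent to K + \<Delta>, whereas
    ampleness concerns the negative; the character accordingly changes sign below.\<close>
  define F where "F = (\<lambda>u. - E u)"
  have F: "F \<in> carrier (TDiv X)" using E(1) by (simp add: F_def carrier_TDiv)
  have "ample X (\<lambda>u. of_int (F u))"
  proof (rule ample_Q_lin_equiv[OF _ E(2)])
    show "ample X (\<lambda>u. - A u)" using \<Delta>(2) by (simp add: log_Fano_def A_def)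
    show "of_nat k * (of_int (F u) - - A u) = (of_int (char_div X m u) :: rat)" for u
      using E(3)[of u] by (simp add: F_def)
  qed
  moreover have "0 < int k * F u + pairing (- m) u \<and> int k * F u + pairing (- m) u < int k" if u: "u \<in> rays X" for u
  proof -
    have eq: "of_int (int k * F u + pairing (- m) u) = of_nat k * - A u"
      using E(3)[of u] u by (simp add: F_def char_div_def pairing_minus_left algebra_simps)
    have "(0 :: rat) < of_nat k * - A u" "of_nat k * - A u < of_nat k"
      using mult_pos_pos[of "of_nat k" "- A u"] mult_strict_left_mono[of "- A u" 1 "of_nat k"] A_in(2,3)[OF u] E(2)
      by simp_all
    then have "(of_int 0 :: rat) < of_int (int k * F u + pairing (- m) u)"
      "(of_int (int k * F u + pairing (- m) u) :: rat) < of_int (int k)"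
      unfolding eq by simp_all
    then show ?thesis unfolding of_int_less_iff by blast
  qed
  ultimately show ?R using F E(2) by blast
next
  assume ?R
  then obtain E q m where E: "E \<in> carrier (TDiv X)" "ample X (\<lambda>u. of_int (E u))" and q: "q \<ge> (1::nat)"
    and strict: "\<And>u. u \<in> rays X \<Longrightarrow> 0 < int q * E u + pairing m u \<and> int q * E u + pairing m u < int q" by blast
  \<comment> \<open>The prospective -(K + \<Delta>), namely E + div(\<chi>^m)/q; the strict
    inequalities put its coefficients on the rays strictly between 0 and 1.\<close>
  define B :: "int ^ 'n \<Rightarrow> rat" where "B = (\<lambda>u. of_int (int q * E u + char_div X m u) / of_nat q)"
  have q0: "(of_nat q :: rat) > 0" using q by simp
  have B_in: "0 < B u" "B u < 1" if "u \<in> rays X" for u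
  proof -
    have "(of_int 0 :: rat) < of_int (int q * E u + char_div X m u)" "(of_int (int q * E u + char_div X m u) :: rat) < of_int (int q)"
      unfolding of_int_less_iff using strict[OF that] that by (simp_all add: char_div_def)
    then show "0 < B u" "B u < 1" unfolding B_def using q0 by (simp_all add: divide_less_eq)
  qed
  have qB: "of_nat q * (B u - of_int (E u)) = of_int (char_div X m u)" for u
    using q0 by (simp add: B_def field_simps)
  define \<Delta> where "\<Delta> = (\<lambda>u. if u \<in> rays X then 1 - B u else 0)"
  have out: "B u = 0" if "u \<notin> rays X" for u
    using that E(1) by (simp add: B_def carrier_TDiv char_div_def)
  have lc: "log_canonical_divisor X \<Delta> = (\<lambda>u. - B u)"
    using out by (auto simp: log_canonical_divisor_def canonical_divisor_def \<Delta>_def)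
  have "toric_boundary X \<Delta>" using B_in by (auto simp: toric_boundary_def \<Delta>_def less_imp_le)
  moreover have "log_Fano X \<Delta>"
    unfolding log_Fano_def lc
  proof
    show "KLT X \<Delta>" using B_in by (auto simp: KLT_def \<Delta>_def)
    show "ample X (\<lambda>u. - (- B u))" using ample_Q_lin_equiv[OF E(2) q qB] by simp
  qed
  moreover have "class_index X \<Delta> = 1"
    unfolding class_index_def
  proof (rule Least_equality)
    have "of_nat q * (of_nat 1 * log_canonical_divisor X \<Delta> u - of_int (- E u)) = of_int (char_div X (- m) u)" for u
      using qB[of u] by (simp add: lc char_div_minus algebra_simps)
    then have "Q_lin_equiv X (\<lambda>u. of_nat 1 * log_canonical_divisor X \<Delta> u) (\<lambda>u. of_int (- E u))"
      unfolding Q_lin_equiv_def principal_eq using q by blast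
    moreover have "(\<lambda>u. - E u) \<in> carrier (TDiv X)" using E(1) by (simp add: carrier_TDiv)
    ultimately show "1 \<le> (1::nat) \<and> (\<exists>E\<in>carrier (TDiv X).
        Q_lin_equiv X (\<lambda>u. of_nat 1 * log_canonical_divisor X \<Delta> u) (\<lambda>u. of_int (E u)))"
      by (intro conjI order_refl bexI[of _ "\<lambda>u. - E u"])
  qed simp
  ultimately show ?L by blast
qed

text \<open>If E were div \<chi>^a, the character q a + m would be positive on every ray, yet
  completeness forces it to be 0.\<close>

lemma div_class_ne_one:
  fixes X :: "('k::field, 'n::finite) toric_variety"
  assumes X: "complete_variety X"
    and strict: "\<And>u. u \<in> rays X \<Longrightarrow> 0 < int q * E u + pairing m u"
  shows "div_class X E \<noteq> \<one>\<^bsub>Cl X\<^esub>"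
proof
  assume "div_class X E = \<one>\<^bsub>Cl X\<^esub>"
  then have "div_class X (\<lambda>u. 0) = div_class X E" by (simp add: one_Cl)
  then obtain a where a: "E = (\<lambda>u. 0 + char_div X a u)" unfolding div_class_eq_iff ..
  define w where "w = real_vec (int q *s a + m)"
  have pos: "0 < w \<bullet> real_vec u" if "u \<in> rays X" for u
    using strict[OF that] that by (simp add: w_def inner_real_vec pairing_add_left pairing_scale_left a char_div_def flip: of_int_mult of_int_add)
  then have "w = 0" by (intro complete_nonneg_imp_0[OF X]) (auto intro: less_imp_le)
  \<comment> \<open>Without rays the positivity is vacuous; but then completeness would make every
    vector vanish, even the all-ones vector.\<close>
  then have "rays X = {}" using pos by auto
  then have "(1 :: real ^ 'n) = 0" by (intro complete_nonneg_imp_0[OF X]) auto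
  then show False by (simp add: vec_eq_iff)
qed

theorem corollary6p3:
  fixes X :: "('k::alg_closed_field, 'n::finite) toric_variety"
  assumes "CHAR('k) > 0"
    and "Q_factorial X"
    and "projective X"
  shows "ample_F_signature X > 0 \<longleftrightarrow>
    (\<exists>\<Delta>. toric_boundary X \<Delta> \<and> log_Fano X \<Delta> \<and> class_index X \<Delta> = 1)"
proof -
  have X: "complete_variety X" using assms(3) by (simp add: projective_def)
  show ?thesis
    unfolding ample_F_signature_pos_iff[OF assms(1) X] exists_log_Fano_iff
  proof
    assume "\<exists>\<epsilon>\<in>AFS X. \<exists>c\<in>\<epsilon>. class_volume X c > 0"
    then obtain \<epsilon> c where \<epsilon>: "\<epsilon> \<in> AFS X" "c \<in> \<epsilon>" "class_volume X c > 0" by blast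
    have "c \<in> carrier (Cl X)" using \<epsilon>(1,2) num_class_subset by (auto simp: AFS_def FS_def)
    then obtain E where E: "E \<in> carrier (TDiv X)" "c = div_class X E" by (auto simp: carrier_Cl)
    have "ample X (\<lambda>u. of_int (E u))" using \<epsilon>(1,2) E unfolding AFS_iff by blast
    then show "\<exists>E\<in>carrier (TDiv X). ample X (\<lambda>u. of_int (E u)) \<and>
       (\<exists>q\<ge>1::nat. \<exists>m. \<forall>u\<in>rays X. 0 < int q * E u + pairing m u \<and> int q * E u + pairing m u < int q)"
      using class_volume_pos_iff[OF X E(1)] \<epsilon>(3) E by blast
  next
    assume "\<exists>E\<in>carrier (TDiv X). ample X (\<lambda>u. of_int (E u)) \<and>
       (\<exists>q\<ge>1::nat. \<exists>m. \<forall>u\<in>rays X. 0 < int q * E u + pairing m u \<and> int q * E u + pairing m u < int q)"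
    then obtain E q m where E: "E \<in> carrier (TDiv X)" "ample X (\<lambda>u. of_int (E u))" and q: "q \<ge> (1::nat)"
      and strict: "\<forall>u\<in>rays X. 0 < int q * E u + pairing m u \<and> int q * E u + pairing m u < int q" by blast
    define c where "c = div_class X E"
    have c: "c \<in> carrier (Cl X)" using E(1) by (simp add: c_def carrier_Cl)
    have vol: "class_volume X c > 0" unfolding c_def class_volume_pos_iff[OF X E(1)] using q strict by blast
    have "c \<noteq> \<one>\<^bsub>Cl X\<^esub>" unfolding c_def using strict by (intro div_class_ne_one[OF X, of q _ m]) blast
    \<comment> \<open>The given q need not be a power of p; the positive volume produces a power of
      p with nonzero multiplicity.\<close>
    then have "num_class X c \<in> FS X" unfolding FS_def using c mult_of_pos[OF assms(1) X c vol] by blast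
    moreover have c_in: "c \<in> num_class X c"
      unfolding c_def mem_num_class[OF E(1)]
      using E(1) by (intro bexI[of _ E] conjI refl exI[of _ 1] exI[of _ 0]) (simp_all add: char_div_zero)
    moreover have "E \<in> c" unfolding c_def mem_div_class by (rule exI[of _ 0]) (simp add: char_div_zero)
    ultimately have "num_class X c \<in> AFS X" using E(2) unfolding AFS_def by blast
    then show "\<exists>\<epsilon>\<in>AFS X. \<exists>c\<in>\<epsilon>. class_volume X c > 0" using c_in vol by blast
  qed
qed

end
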